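(* Let $m\in\mathbb{N}$ and let $p$ be a minimal idempotent in $(\beta\mathbb{N},+)$. Then for every $A\in\bigotimes_{i=1}^m p$ and every $T\in\mathcal{P}_f(\mathbb{P})$ there exist functions $\alpha:\mathcal{P}_f(\mathbb{N}^{\mathbb{N}})\to\mathbb{N}$ and $H:\mathcal{P}_f(\mathbb{N}^{\mathbb{N}})\to\mathcal{P}_f(\mathbb{N})$ such that (1) if $G,K\in\mathcal{P}_f(\mathbb{N}^{\mathbb{N}})$ and $G\subsetneq K$, then $H(G)<H(K)$; and (2) if $G_1\subsetneq G_2\subsetneq\cdots\subsetneq G_n\subsetneq\cdots$ is an infinite sequence in $\mathcal{P}_f(\mathbb{N}^{\mathbb{N}})$, then for all $\beta_1<\beta_2<\cdots<\beta_m$ in $\mathcal{P}_f(\mathbb{N})$, all $f_i\in G_i$ ($i\in\mathbb{N}$), and all $P_1,\ldots,P_m\in T$, $$\left(\sum_{i\in\beta_1}\alpha(G_i)+P_1\Bigl(\sum_{i\in\beta_1}\sum_{t\in H(G_i)}f_i(t)\Bigr),\ldots,\sum_{i\in\beta_m}\alpha(G_i)+P_m\Bigl(\sum_{i\in\beta_m}\sum_{t\in H(G_i)}f_i(t)\Bigr)\right)\in A.$$ In fact, the same holds for every idempotent $p$ of $(\mathcal{J}_p,+)$ (in place of a minimal idempotent).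
   Context: $\mathbb{N}$ is the set of positive integers; $\mathcal{P}_f(X)$ is the set of nonempty finite subsets of $X$; $\mathbb{N}^{\mathbb{N}}$ is the set of all functions $\mathbb{N}\to\mathbb{N}$. For $\beta,\gamma\in\mathcal{P}_f(\mathbb{N})$, $\beta<\gamma$ means $\max\beta<\min\gamma$. $\mathbb{P}$ is the set of one-variable polynomials with integer coefficients and zero constant term. $\beta\mathbb{N}$ is the set of ultrafilters on $\mathbb{N}$, with the Stone topology and the operation: $A\in p+q$ iff $\{x\in\mathbb{N}:-x+A\in q\}\in p$, where $-x+A=\{y\in\mathbb{N}:x+y\in A\}$. An ultrafilter $p$ is idempotent if $p+p=p$; a minimal idempotent is an idempotent lying in $K(\beta\mathbb{N},+)$, the smallest two-sided ideal (the union of all minimal left ideals) of $(\beta\mathbb{N},+)$. A set $A\subseteq\mathbb{N}$ is a $J_p$-set if for every $F\in\mathcal{P}_f(\mathbb{P})$ and every $H\in\mathcal{P}_f(\mathbb{N}^{\mathbb{N}})$ there exist $a\in\mathbb{N}$ and $\beta\in\mathcal{P}_f(\mathbb{N})$ such that $a+P(\sum_{t\in\beta}f(t))\in A$ for all $P\in F$ and $f\in H$. $\mathcal{J}_p=\{q\in\beta\mathbb{N}:\text{every }A\in q\text{ is a }J_p\text{-set}\}$ (the subscript $p$ stands for "polynomial" and is not an ultrafilter); it is a two-sided ideal of $(\beta\mathbb{N},+)$. Tensor products: for ultrafilters $p_1,\ldots,p_k$ on $\mathbb{N}$, $\bigotimes_{i=1}^k p_i$ is the ultrafilter on $\mathbb{N}^k$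 defined recursively by $\bigotimes_{i=1}^1p_i=p_1$, and, for $A\subseteq\mathbb{N}^{k+1}$, $A\in\bigotimes_{i=1}^{k+1}p_i$ iff $\{(x_1,\ldots,x_k)\in\mathbb{N}^k:\{x_{k+1}\in\mathbb{N}:(x_1,\ldots,x_{k+1})\in A\}\in p_{k+1}\}\in\bigotimes_{i=1}^kp_i$. $\bigotimes_{i=1}^mp$ is the case $p_i=p$ for all $i$. *)

theory Defs
  imports Complex_Main "HOL-Library.FuncSet" "HOL-Computational_Algebra.Polynomial"
begin

text \<open>The positive integers are the subset \<open>{1..}\<close> of type \<^typ>\<open>nat\<close>. Sequences in them are
  extensional functions, so that two sequences are equal iff they agree on the positive integers.\<close>

abbreviation pos_nats :: "nat set" where
  "pos_nats \<equiv> {1..}"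

abbreviation pos_seqs :: "(nat \<Rightarrow> nat) set" where
  "pos_seqs \<equiv> pos_nats \<rightarrow>\<^sub>E pos_nats"

abbreviation pos_tuples :: "nat \<Rightarrow> nat list set" where
  "pos_tuples k \<equiv> {xs. length xs = k \<and> set xs \<subseteq> pos_nats}"

definition Pf :: "'a set \<Rightarrow> 'a set set" where
  "Pf X = {F. F \<subseteq> X \<and> finite F \<and> F \<noteq> {}}"

definition block_less :: "nat set \<Rightarrow> nat set \<Rightarrow> bool" where
  "block_less \<beta> \<gamma> \<longleftrightarrow> Max \<beta> < Min \<gamma>"

definition int_polys0 :: "int poly set" where
  "int_polys0 = {P. coeff P 0 = 0}"


text \<open>A set \<open>A\<close> belongs to the ultrafilter \<open>p\<close> iff \<^term>\<open>\<forall>\<^sub>F x in p. x \<in> A\<close>.\<close>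

definition ultrafilter :: "'a filter \<Rightarrow> bool" where
  "ultrafilter p \<longleftrightarrow> p \<noteq> bot \<and> (\<forall>A. (\<forall>\<^sub>F x in p. x \<in> A) \<or> (\<forall>\<^sub>F x in p. x \<notin> A))"

text \<open>Ultrafilters on the positive integers are identified with the ultrafilters on \<^typ>\<open>nat\<close> that
  contain the set of positive integers. Only the semigroup structure on them is needed below, not
  their topology.\<close>

definition beta_N :: "nat filter set" where
  "beta_N = {p. ultrafilter p \<and> (\<forall>\<^sub>F x in p. x \<in> pos_nats)}"

definition uf_add :: "nat filter \<Rightarrow> nat filter \<Rightarrow> nat filter" (infixl "\<oplus>\<^sub>\<beta>" 65) where
  "p \<oplus>\<^sub>\<beta> q = Abs_filter (\<lambda>P. \<forall>\<^sub>F x in p. \<forall>\<^sub>F y in q. P (x + y))"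

lemma is_filter_iterated:
  "is_filter (\<lambda>P. \<forall>\<^sub>F x in p. \<forall>\<^sub>F y in q. P (h x y))"
proof
  show "\<forall>\<^sub>F x in p. \<forall>\<^sub>F y in q. True" by simp
next
  fix P Q
  assume "\<forall>\<^sub>F x in p. \<forall>\<^sub>F y in q. P (h x y)" "\<forall>\<^sub>F x in p. \<forall>\<^sub>F y in q. Q (h x y)"
  then show "\<forall>\<^sub>F x in p. \<forall>\<^sub>F y in q. P (h x y) \<and> Q (h x y)"
    by (simp add: eventually_conj_iff)
next
  fix P Q
  assume "\<forall>z. P z \<longrightarrow> Q z" "\<forall>\<^sub>F x in p. \<forall>\<^sub>F y in q. P (h x y)"
  then show "\<forall>\<^sub>F x in p. \<forall>\<^sub>F y in q. Q (h x y)"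
    by (auto elim!: eventually_mono)
qed

lemma eventually_uf_add:
  "(\<forall>\<^sub>F z in p \<oplus>\<^sub>\<beta> q. P z) \<longleftrightarrow> (\<forall>\<^sub>F x in p. \<forall>\<^sub>F y in q. P (x + y))"
  unfolding uf_add_def by (rule eventually_Abs_filter[OF is_filter_iterated])

lemma ultrafilter_not_eventually:
  assumes "ultrafilter p"
  shows "(\<forall>\<^sub>F x in p. \<not> P x) \<longleftrightarrow> \<not> (\<forall>\<^sub>F x in p. P x)"
proof
  assume 1: "\<forall>\<^sub>F x in p. \<not> P x"
  show "\<not> (\<forall>\<^sub>F x in p. P x)"
  proof
    assume "\<forall>\<^sub>F x in p. P x"
    with 1 have "\<forall>\<^sub>F x in p. False" by eventually_elim simp
    then show False using assms by (simp add: ultrafilter_def trivial_limit_def)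
  qed
next
  have "(\<forall>\<^sub>F x in p. x \<in> Collect P) \<or> (\<forall>\<^sub>F x in p. x \<notin> Collect P)"
    using assms unfolding ultrafilter_def by blast
  moreover assume "\<not> (\<forall>\<^sub>F x in p. P x)"
  ultimately show "\<forall>\<^sub>F x in p. \<not> P x" by simp
qed

lemma uf_add_closed:
  assumes "p \<in> beta_N" "q \<in> beta_N"
  shows "p \<oplus>\<^sub>\<beta> q \<in> beta_N"
proof -
  have u: "ultrafilter p" "ultrafilter q"
    and pos: "\<forall>\<^sub>F x in p. x \<in> pos_nats" using assms by (auto simp: beta_N_def)
  note neg = ultrafilter_not_eventually[OF u(1)] ultrafilter_not_eventually[OF u(2)]
  have "\<not> (\<forall>\<^sub>F z in p \<oplus>\<^sub>\<beta> q. z \<in> {})"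
    unfolding eventually_uf_add using u by (simp add: ultrafilter_def)
  then have "p \<oplus>\<^sub>\<beta> q \<noteq> bot" by auto
  moreover have "(\<forall>\<^sub>F z in p \<oplus>\<^sub>\<beta> q. z \<in> A) \<or> (\<forall>\<^sub>F z in p \<oplus>\<^sub>\<beta> q. z \<notin> A)" for A
    unfolding eventually_uf_add neg by blast
  moreover have "\<forall>\<^sub>F z in p \<oplus>\<^sub>\<beta> q. z \<in> pos_nats"
    unfolding eventually_uf_add using pos by eventually_elim simp
  ultimately show ?thesis by (simp add: beta_N_def ultrafilter_def)
qed

definition uf_idempotent :: "nat filter \<Rightarrow> bool" where
  "uf_idempotent p \<longleftrightarrow> p \<in> beta_N \<and> p \<oplus>\<^sub>\<beta> p = p"

definition uf_ideal :: "nat filter set \<Rightarrow> bool" where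
  "uf_ideal I \<longleftrightarrow> I \<noteq> {} \<and> I \<subseteq> beta_N \<and> (\<forall>p\<in>beta_N. \<forall>q\<in>I. p \<oplus>\<^sub>\<beta> q \<in> I \<and> q \<oplus>\<^sub>\<beta> p \<in> I)"

definition K_beta_N :: "nat filter set" where
  "K_beta_N = \<Inter> {I. uf_ideal I}"

definition minimal_idempotent :: "nat filter \<Rightarrow> bool" where
  "minimal_idempotent p \<longleftrightarrow> uf_idempotent p \<and> p \<in> K_beta_N"


text \<open>Polynomial values may be negative, so membership is stated in \<^typ>\<open>int\<close>, in the image of the set.\<close>

definition Jp_set :: "nat set \<Rightarrow> bool" where
  "Jp_set A \<longleftrightarrow> A \<subseteq> pos_nats \<and>
    (\<forall>F \<in> Pf int_polys0. \<forall>H \<in> Pf pos_seqs. \<exists>a \<in> pos_nats. \<exists>\<beta> \<in> Pf pos_nats.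
      \<forall>P\<in>F. \<forall>f\<in>H. int a + poly P (int (\<Sum>t\<in>\<beta>. f t)) \<in> int ` A)"

definition Jp :: "nat filter set" where
  "Jp = {q \<in> beta_N. \<forall>A. A \<subseteq> pos_nats \<longrightarrow> (\<forall>\<^sub>F x in q. x \<in> A) \<longrightarrow> Jp_set A}"


text \<open>The tensor product of \<open>p 1, \<dots>, p k\<close>, with \<open>k\<close>-tuples as lists of length \<open>k\<close>; the empty
  product is a convention only.\<close>

fun tensor :: "(nat \<Rightarrow> 'a filter) \<Rightarrow> nat \<Rightarrow> 'a list filter" where
  "tensor p 0 = principal {[]}"
| "tensor p (Suc 0) = filtermap (\<lambda>x. [x]) (p 1)"
| "tensor p (Suc (Suc k)) =
     Abs_filter (\<lambda>P. \<forall>\<^sub>F xs in tensor p (Suc k). \<forall>\<^sub>F x in p (Suc (Suc k)). P (xs @ [x]))"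

lemma eventually_tensor_1:
  "(\<forall>\<^sub>F xs in tensor p 1. xs \<in> A) \<longleftrightarrow> (\<forall>\<^sub>F x in p 1. [x] \<in> A)"
  by (simp add: eventually_filtermap)

lemma eventually_tensor_Suc:
  assumes "k \<ge> 1"
  shows "(\<forall>\<^sub>F ys in tensor p (Suc k). ys \<in> A) \<longleftrightarrow>
    (\<forall>\<^sub>F xs in tensor p k. \<forall>\<^sub>F x in p (Suc k). xs @ [x] \<in> A)"
  using assms
  by (cases k) (simp_all add: eventually_Abs_filter[OF is_filter_iterated])

end

theory Submission
  imports Defs "HOL-Library.Multiset"
begin

text \<open>
The combinatorial core is an IP polynomial van der Waerden theorem: for a finite colouring of the
integers and finitely many polynomial set maps \<open>v\<close>, some point \<open>a\<close> has the colour of all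
\<open>a + v \<beta>\<close>, for a common finite set \<open>\<beta>\<close>. As in Walters' proof, it follows by colour focusing and PET
induction: subtracting a map of least degree from all the translates of the maps replaces one class
of degree \<open>d\<close>, modulo lower degree, by finitely many classes of degree \<open>d - 1\<close>. The theorem makes
\<open>Jp\<close> nonempty, hence an ideal, hence it contains every minimal idempotent.

For an idempotent \<open>p\<close> in \<open>Jp\<close> the functions \<open>\<alpha>\<close> and \<open>H\<close> are chosen by recursion on \<open>G\<close>. Only finitely
many states (completed entries, \<open>\<alpha>\<close>-sum, polynomial, argument) arise from chains below \<open>G\<close>. Each
current value \<open>z\<close> lies in a star set, so adding \<open>p\<close>-almost every \<open>x\<close> keeps it there. An increment
\<open>a + (P (y + u) - P y)\<close> is of Jp-set form, as \<open>P (y + u) - P y\<close> has no constant term in \<open>u\<close>.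
\<close>

section \<open>Set maps of bounded degree and PET induction\<close>

text \<open>The threshold confines the degree conditions to sets lying beyond everything already
  used, so that the unions formed below are disjoint.\<close>

definition fin_above :: "nat \<Rightarrow> nat set set" where
  "fin_above l = {\<beta>. finite \<beta> \<and> \<beta> \<subseteq> {l<..}}"

text \<open>Maps with value \<open>0\<close> at the empty set. Degree \<open>0\<close> means identically zero beyond \<open>l\<close>, degree \<open>1\<close>
  additive on disjoint ordered sets.\<close>

primrec deg_le :: "nat \<Rightarrow> nat \<Rightarrow> (nat set \<Rightarrow> int) \<Rightarrow> bool" where
  "deg_le 0 l v \<longleftrightarrow> (\<forall>\<beta>\<in>fin_above l. v \<beta> = 0)"
| "deg_le (Suc d) l v \<longleftrightarrow> v {} = 0 \<and>
    (\<forall>l'\<ge>l. \<forall>\<alpha>\<in>Pow {l<..l'}. deg_le d l' (\<lambda>\<beta>. v (\<alpha> \<union> \<beta>) - v \<alpha> - v \<beta>))"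

lemma fin_above_mono: "l \<le> l' \<Longrightarrow> fin_above l' \<subseteq> fin_above l"
  by (auto simp: fin_above_def)

lemma empty_in_fin_above [simp]: "{} \<in> fin_above l"
  by (simp add: fin_above_def)

lemma deg_le_empty: "deg_le d l v \<Longrightarrow> v {} = 0"
  by (cases d) auto

lemma deg_le_mono_tail: "deg_le d l v \<Longrightarrow> l \<le> l' \<Longrightarrow> deg_le d l' v"
proof (cases d)
  case (Suc e)
  assume "deg_le d l v" "l \<le> l'"
  moreover from \<open>l \<le> l'\<close> have "Pow {l'<..k} \<subseteq> Pow {l<..k}" for k by auto
  ultimately show ?thesis unfolding Suc deg_le.simps by (meson order_trans subsetD)
qed (use fin_above_mono in auto)

lemma deg_le_diff:
  "deg_le d l v \<Longrightarrow> deg_le d l w \<Longrightarrow> deg_le d l (\<lambda>\<beta>. v \<beta> - w \<beta>)"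
proof (induction d arbitrary: l v w)
  case (Suc d)
  have "deg_le d l' (\<lambda>\<beta>. v (\<alpha> \<union> \<beta>) - w (\<alpha> \<union> \<beta>) - (v \<alpha> - w \<alpha>) - (v \<beta> - w \<beta>))"
    if "l' \<ge> l" "\<alpha> \<in> Pow {l<..l'}" for l' \<alpha>
  proof -
    have "deg_le d l' (\<lambda>\<beta>. v (\<alpha> \<union> \<beta>) - v \<alpha> - v \<beta> - (w (\<alpha> \<union> \<beta>) - w \<alpha> - w \<beta>))"
      by (rule Suc.IH) (use Suc.prems that in simp_all)
    then show ?thesis by (simp add: algebra_simps)
  qed
  then show ?case using Suc.prems by simp
qed simp

lemma deg_le_zero: "deg_le d l (\<lambda>_. 0)"
  by (induction d arbitrary: l) auto

lemma deg_le_add: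
  assumes "deg_le d l v" "deg_le d l w" shows "deg_le d l (\<lambda>\<beta>. v \<beta> + w \<beta>)"
  using deg_le_diff[OF assms(1) deg_le_diff[OF deg_le_zero assms(2)]] by simp

lemma deg_le_Suc: "deg_le d l v \<Longrightarrow> deg_le (Suc d) l v"
proof (induction d arbitrary: l v)
  case 0
  \<comment> \<open>All three sets lie beyond \<open>l\<close>, where a map of degree 0 vanishes, so
    the defect of additivity is 0.\<close>
  have "\<alpha> \<in> fin_above l" "\<beta> \<in> fin_above l" "\<alpha> \<union> \<beta> \<in> fin_above l"
    if "l \<le> l'" "\<alpha> \<in> Pow {l<..l'}" "\<beta> \<in> fin_above l'" for l' \<alpha> \<beta>
    using that finite_subset[of \<alpha> "{l<..l'}"] by (auto simp: fin_above_def)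
  with 0 show ?case by simp
next
  case (Suc d)
  then show ?case by (subst deg_le.simps(2)) (metis deg_le.simps(2))
qed

lemma deg_le_mono: "deg_le d l v \<Longrightarrow> d \<le> e \<Longrightarrow> deg_le e l v"
  by (induction e) (auto simp: le_Suc_eq simp del: deg_le.simps intro: deg_le_Suc)

lemma deg_le_derivative:
  "deg_le (Suc d) l v \<Longrightarrow> l \<le> l' \<Longrightarrow> \<alpha> \<in> Pow {l<..l'} \<Longrightarrow>
    deg_le d l' (\<lambda>\<beta>. v (\<alpha> \<union> \<beta>) - v \<alpha> - v \<beta>)"
  by simp

text \<open>The finite set \<open>D\<close> is uniform in the colouring: this replaces a compactness argument, and allows
  a later translation into the positive integers.\<close>

definition recurrent :: "nat \<Rightarrow> (nat set \<Rightarrow> int) set \<Rightarrow> bool" where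
  "recurrent l A \<longleftrightarrow> (\<forall>C::nat set. finite C \<longrightarrow> (\<exists>D. finite D \<and> D \<subseteq> UNIV \<times> (fin_above l - {{}}) \<and>
    (\<forall>c::int \<Rightarrow> nat. range c \<subseteq> C \<longrightarrow> (\<exists>(a, \<beta>)\<in>D. \<forall>v\<in>A. c (a + v \<beta>) = c a))))"

text \<open>Colour focusing: the induction is on the number \<open>r\<close> of colours focused on one point. The hypothesis
  is applied to the colouring by blocks, that is, by the colours at all the offsets in \<open>O'\<close>.\<close>

lemma recurrent_step:
  assumes finA: "finite A" and zero: "\<And>v. v \<in> A \<Longrightarrow> v {} = 0"
    and IH: "\<And>l'. l \<le> l' \<Longrightarrow>
      recurrent l' ((\<lambda>(v, \<alpha>) \<beta>. v (\<alpha> \<union> \<beta>) - v \<alpha> - p \<beta>) ` (A \<times> Pow {l<..l'}))"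
  shows "recurrent l A"
  unfolding recurrent_def
proof (intro allI impI)
  fix C :: "nat set" assume finC: "finite C"
  define mono :: "int set \<Rightarrow> nat set set \<Rightarrow> (int \<Rightarrow> nat) \<Rightarrow> bool"
    where "mono E \<Gamma> c \<longleftrightarrow> (\<exists>a\<in>E. \<exists>\<beta>\<in>\<Gamma>. \<forall>v\<in>A. c (a + v \<beta>) = c a)" for E \<Gamma> c
  define foc :: "nat \<Rightarrow> int set \<Rightarrow> nat set set \<Rightarrow> (int \<Rightarrow> nat) \<Rightarrow> bool"
    where "foc r E \<Gamma> c \<longleftrightarrow>
      (\<exists>a\<in>E. \<exists>X\<subseteq>C. card X = r \<and> (\<forall>\<chi>\<in>X. \<exists>\<gamma>\<in>\<Gamma>. \<forall>v\<in>A. c (a + v \<gamma>) = \<chi>))" for r E \<Gamma> c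
  \<comment> \<open>\<open>E\<close> and \<open>\<Gamma>\<close> are fixed before the colouring is
    given; their product is the uniform \<open>D\<close> at the end.\<close>
  have focus: "\<exists>E \<Gamma>. finite E \<and> finite \<Gamma> \<and> \<Gamma> \<subseteq> fin_above l - {{}} \<and>
      (\<forall>c. range c \<subseteq> C \<longrightarrow> mono E \<Gamma> c \<or> foc r E \<Gamma> c)" for r
  proof (induction r)
    case 0
    have "foc 0 {0} {} c" for c unfolding foc_def by auto
    then show ?case by (intro exI[of _ "{0}"] exI[of _ "{}"]) auto
  next
    case (Suc r)
    then obtain E \<Gamma> where fin: "finite E" "finite \<Gamma>" and \<Gamma>: "\<Gamma> \<subseteq> fin_above l - {{}}"
      and alt: "\<And>c. range c \<subseteq> C \<Longrightarrow> mono E \<Gamma> c \<or> foc r E \<Gamma> c" by blast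
    \<comment> \<open>Every set in \<open>\<Gamma>\<close> fits below \<open>l'\<close>, so it may
      serve as an index \<alpha> in \<open>IH\<close>, and the new set \<beta> lies beyond
      it.\<close>
    define l' where "l' = Max (insert l (\<Union>\<Gamma>))"
    have finU: "finite (\<Union>\<Gamma>)" using fin \<Gamma> by (auto simp: fin_above_def)
    have "l \<le> l'" using finU by (simp add: l'_def)
    have \<Gamma>': "\<gamma> \<in> Pow {l<..l'}" if "\<gamma> \<in> \<Gamma>" for \<gamma>
    proof
      show "\<gamma> \<subseteq> {l<..l'}"
      proof
        fix t assume "t \<in> \<gamma>"
        then have "t \<le> l'" using that finU by (auto simp: l'_def intro!: Max_ge)
        then show "t \<in> {l<..l'}" using that \<Gamma> \<open>t \<in> \<gamma>\<close> by (auto simp: fin_above_def)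
      qed
    qed
    \<comment> \<open>These are the offsets at which the earlier alternative inspects a
      colouring.\<close>
    define O' where "O' = E \<union> (\<lambda>(a, v, \<gamma>). a + v \<gamma>) ` (E \<times> A \<times> \<Gamma>)"
    have finO: "finite O'" using fin finA by (auto simp: O'_def)
    define B where "B = (O' \<rightarrow>\<^sub>E C)"
    have "finite B" unfolding B_def using finO finC by (intro finite_PiE) auto
    \<comment> \<open>Blocks of colours are coded by natural numbers, the only colours that
      \<open>recurrent\<close> admits.\<close>
    then obtain g :: "(int \<Rightarrow> nat) \<Rightarrow> nat" where g: "inj_on g B"
      using finite_imp_inj_to_nat_seg by metis
    obtain D where finD: "finite D" and D: "D \<subseteq> UNIV \<times> (fin_above l' - {{}})"
      and Dc: "\<And>c. range c \<subseteq> g ` B \<Longrightarrow> \<exists>(a, \<beta>)\<in>D. \<forall>v\<in>A. \<forall>\<alpha>\<in>Pow {l<..l'}.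
          c (a + (v (\<alpha> \<union> \<beta>) - v \<alpha> - p \<beta>)) = c a"
    proof -
      have "finite (g ` B)" using \<open>finite B\<close> by simp
      from IH[OF \<open>l \<le> l'\<close>, unfolded recurrent_def, rule_format, OF this] show ?thesis
        by (elim exE conjE) (rule that, auto)
    qed
    \<comment> \<open>\<open>a + b\<close> is the translated old point and
      \<open>a + b - p \<beta>\<close> the new focus. The set \<beta> will carry the colour of the
      old point, and \<open>\<gamma> \<union> \<beta>\<close> the old colours.\<close>
    define E' where "E' = (\<lambda>(a, b, \<beta>). a + b) ` (E \<times> D) \<union> (\<lambda>(a, b, \<beta>). a + b - p \<beta>) ` (E \<times> D)"
    define \<Gamma>'' where "\<Gamma>'' = \<Gamma> \<union> snd ` D \<union> (\<lambda>(\<gamma>, b, \<beta>). \<gamma> \<union> \<beta>) ` (\<Gamma> \<times> D)"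
    have "finite E'" "finite \<Gamma>''" using fin finD by (auto simp: E'_def \<Gamma>''_def)
    moreover have "\<Gamma>'' \<subseteq> fin_above l - {{}}"
    proof -
      have D': "\<beta> \<in> fin_above l - {{}}" if "(b, \<beta>) \<in> D" for b \<beta>
        using that D fin_above_mono[OF \<open>l \<le> l'\<close>] by blast
      moreover have "\<gamma> \<union> \<beta> \<in> fin_above l - {{}}" if "\<gamma> \<in> \<Gamma>" "(b, \<beta>) \<in> D" for \<gamma> b \<beta>
        using D'[OF that(2)] that(1) \<Gamma> by (auto simp: fin_above_def)
      ultimately show ?thesis using \<Gamma> unfolding \<Gamma>''_def by auto
    qed
    moreover have "mono E' \<Gamma>'' c \<or> foc (Suc r) E' \<Gamma>'' c" if c: "range c \<subseteq> C" for c
    proof -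
      define c' where "c' x = g (restrict (\<lambda>o'. c (x + o')) O')" for x
      have inB: "restrict (\<lambda>o'. c (x + o')) O' \<in> B" for x using c by (auto simp: B_def)
      then have "range c' \<subseteq> g ` B" by (auto simp: c'_def)
      from Dc[OF this] obtain b \<beta> where b: "(b, \<beta>) \<in> D"
        and b': "\<And>v \<alpha>. v \<in> A \<Longrightarrow> \<alpha> \<in> Pow {l<..l'} \<Longrightarrow> c' (b + (v (\<alpha> \<union> \<beta>) - v \<alpha> - p \<beta>)) = c' b"
        by blast
      \<comment> \<open>With \<open>\<alpha> = \<gamma>\<close> and
        \<open>o' = a + v \<gamma>\<close> the left argument is
        \<open>a + b - p \<beta> + v (\<gamma> \<union> \<beta>)\<close>; with \<alpha> empty and
        \<open>o' = a\<close> it is \<open>a + b - p \<beta> + v \<beta>\<close>.\<close>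
      have eq: "c (b + (v (\<alpha> \<union> \<beta>) - v \<alpha> - p \<beta>) + o') = c (b + o')"
        if "v \<in> A" "\<alpha> \<in> Pow {l<..l'}" "o' \<in> O'" for v \<alpha> o'
        using inj_onD[OF g b'[OF that(1,2), unfolded c'_def] inB inB, THEN fun_cong, of o'] that(3)
        by simp
      have "range (\<lambda>x. c (b + x)) \<subseteq> C" using c by auto
      from alt[OF this] show ?thesis
      proof
        assume "mono E \<Gamma> (\<lambda>x. c (b + x))"
        then obtain a \<gamma> where a: "a \<in> E" "\<gamma> \<in> \<Gamma>" "\<forall>v\<in>A. c (b + (a + v \<gamma>)) = c (b + a)"
          by (auto simp: mono_def)
        then have "mono E' \<Gamma>'' c" unfolding mono_def using b
          by (intro bexI[of _ "a + b"] bexI[of _ \<gamma>])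
            (auto simp: E'_def \<Gamma>''_def add_ac intro: rev_image_eqI)
        then show ?thesis ..
      next
        assume "foc r E \<Gamma> (\<lambda>x. c (b + x))"
        then obtain a X where a: "a \<in> E" and X: "X \<subseteq> C" "card X = r"
          and Xc: "\<And>\<chi>. \<chi> \<in> X \<Longrightarrow> \<exists>\<gamma>\<in>\<Gamma>. \<forall>v\<in>A. c (b + (a + v \<gamma>)) = \<chi>"
          by (auto simp: foc_def)
        show ?thesis
        \<comment> \<open>If the old focus has one of the focused colours, the conclusion holds
          there; otherwise its own colour is the additional one.\<close>
        proof (cases "c (b + a) \<in> X")
          case True
          from Xc[OF this] obtain \<gamma> where "\<gamma> \<in> \<Gamma>" "\<forall>v\<in>A. c (b + (a + v \<gamma>)) = c (b + a)" by blast
          then have "mono E' \<Gamma>'' c" unfolding mono_def using a b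
            by (intro bexI[of _ "a + b"] bexI[of _ \<gamma>])
              (auto simp: E'_def \<Gamma>''_def add_ac intro: rev_image_eqI)
          then show ?thesis ..
        next
          case False
          have "\<exists>\<gamma>\<in>\<Gamma>''. \<forall>v\<in>A. c (a + b - p \<beta> + v \<gamma>) = \<chi>" if \<chi>: "\<chi> \<in> insert (c (b + a)) X" for \<chi>
          proof (cases "\<chi> = c (b + a)")
            case True
            have "c (a + b - p \<beta> + v \<beta>) = \<chi>" if "v \<in> A" for v
              using eq[OF that, of "{}" a] zero[OF that] a True by (simp add: O'_def algebra_simps)
            moreover have "\<beta> \<in> \<Gamma>''" using b by (auto simp: \<Gamma>''_def intro: rev_image_eqI)
            ultimately show ?thesis by blast
          next
            case False
            with \<chi> Xc obtain \<gamma> where \<gamma>: "\<gamma> \<in> \<Gamma>" "\<forall>v\<in>A. c (b + (a + v \<gamma>)) = \<chi>" by blast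
            have "c (a + b - p \<beta> + v (\<gamma> \<union> \<beta>)) = \<chi>" if "v \<in> A" for v
            proof -
              have "a + v \<gamma> \<in> O'" using a \<gamma>(1) that by (force simp: O'_def)
              from eq[OF that \<Gamma>'[OF \<gamma>(1)] this] \<gamma>(2) that show ?thesis by (simp add: algebra_simps)
            qed
            moreover have "\<gamma> \<union> \<beta> \<in> \<Gamma>''" using b \<gamma>(1) by (force simp: \<Gamma>''_def)
            ultimately show ?thesis by blast
          qed
          moreover have "a + b - p \<beta> \<in> E'" using a b by (force simp: E'_def)
          moreover have "card (insert (c (b + a)) X) = Suc r"
            using False X finC by (simp add: finite_subset)
          moreover have "insert (c (b + a)) X \<subseteq> C" using X c by auto
          ultimately have "foc (Suc r) E' \<Gamma>'' c" unfolding foc_def by blast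
          then show ?thesis ..
        qed
      qed
    qed
    ultimately show ?case by blast
  qed
  obtain E \<Gamma> where fin: "finite E" "finite \<Gamma>" and \<Gamma>: "\<Gamma> \<subseteq> fin_above l - {{}}"
    and alt: "\<And>c. range c \<subseteq> C \<Longrightarrow> mono E \<Gamma> c \<or> foc (Suc (card C)) E \<Gamma> c"
    using focus[of "Suc (card C)"] by blast
  \<comment> \<open>There are not enough colours in \<open>C\<close> for this many to be
    focused.\<close>
  have "\<not> foc (Suc (card C)) E \<Gamma> c" for c
    using card_mono[OF finC] by (auto simp: foc_def) (metis Suc_n_not_le_n)
  with alt have *: "mono E \<Gamma> c" if "range c \<subseteq> C" for c using that by blast
  show "\<exists>D. finite D \<and> D \<subseteq> UNIV \<times> (fin_above l - {{}}) \<and>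
    (\<forall>c::int \<Rightarrow> nat. range c \<subseteq> C \<longrightarrow> (\<exists>(a, \<beta>)\<in>D. \<forall>v\<in>A. c (a + v \<beta>) = c a))"
    using fin \<Gamma> * unfolding mono_def by (intro exI[of _ "E \<times> \<Gamma>"]) auto
qed

text \<open>A pair \<open>(d, q)\<close> stands for the class of the maps that differ from \<open>q\<close> by a map of degree at most
  \<open>d\<close>, where \<open>q\<close> has degree at most \<open>d + 1\<close>.\<close>

definition covered :: "nat \<Rightarrow> (nat set \<Rightarrow> int) set \<Rightarrow> (nat \<times> (nat set \<Rightarrow> int)) multiset \<Rightarrow> bool" where
  "covered l A R \<longleftrightarrow> (\<forall>(d, q)\<in>#R. deg_le (Suc d) l q) \<and>
    (\<forall>v\<in>A. \<exists>(d, q)\<in>#R. deg_le d l (\<lambda>\<beta>. v \<beta> - q \<beta>))"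

text \<open>The induction runs over the multiset of degrees of the classes; the representatives are
  forgotten. Maps of degree 0 need no class, as they vanish beyond \<open>l\<close>.\<close>

lemma recurrent_covered:
  "finite A \<Longrightarrow> covered l {v \<in> A. \<not> deg_le 0 l v} R \<Longrightarrow> recurrent l A"
proof (induction "image_mset fst R" arbitrary: A l R rule: wf_induct_rule[OF wf_mult1[OF wf_less_than]])
  case (1 R A l)
  define A1 where "A1 = {v \<in> A. \<not> deg_le 0 l v}"
  have cov: "covered l A1 R" using 1 by (simp add: A1_def)
  have finA1: "finite A1" using 1 by (simp add: A1_def)
  have "recurrent l A1"
  proof (cases "R = {#}")
    case True
    then have "A1 = {}" using cov by (auto simp: covered_def)
    \<comment> \<open>No map is left, so any nonempty set beyond \<open>l\<close> works.\<close>
    then show ?thesis unfolding recurrent_def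
      by (intro allI impI exI[of _ "{(0, {Suc l})}"]) (auto simp: fin_above_def)
  next
    case False
    \<comment> \<open>The degree is taken least so that subtracting a map of this class preserves
      the degree bounds of the other representatives.\<close>
    then obtain d q where dq: "(d, q) \<in># R" and min: "\<And>e q'. (e, q') \<in># R \<Longrightarrow> d \<le> e"
      using Min_in[of "fst ` set_mset R"] Min_le[of "fst ` set_mset R"] by fastforce
    define R0 where "R0 = R - {#(d, q)#}"
    have R: "R = add_mset (d, q) R0" using dq by (simp add: R0_def)
    show ?thesis
    proof (cases "\<exists>p\<in>A1. deg_le d l (\<lambda>\<beta>. p \<beta> - q \<beta>)")
      case False
      \<comment> \<open>A class without members is dropped, which already decreases the
        multiset.\<close>
      then have "covered l A1 R0" using cov by (auto simp: covered_def R)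
      then have "covered l {v \<in> A1. \<not> deg_le 0 l v} R0" by (auto simp: covered_def)
      moreover have "(image_mset fst R0, image_mset fst R) \<in> mult1 less_than"
        by (rule mult1I[of _ d _ _ "{#}"]) (auto simp: R)
      ultimately show ?thesis using 1(1) finA1 by blast
    next
      case True
      then obtain p where p: "p \<in> A1" "deg_le d l (\<lambda>\<beta>. p \<beta> - q \<beta>)" by blast
      have degq: "deg_le (Suc e) l q'" if "(e, q') \<in># R" for e q'
        using cov that by (auto simp: covered_def simp del: deg_le.simps)
      have degv: "deg_le (Suc e) l v"
        if "(e, q') \<in># R" "deg_le e l (\<lambda>\<beta>. v \<beta> - q' \<beta>)" for e q' v
        using deg_le_add[OF deg_le_Suc[OF that(2)] degq[OF that(1)]] by simp
      show ?thesis
      proof (rule recurrent_step[OF finA1, where p = p])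
        fix v assume "v \<in> A1"
        then show "v {} = 0" using cov degv deg_le_empty
          unfolding covered_def by blast
      next
        fix l' assume l': "l \<le> l'"
        define A' where "A' = (\<lambda>(v, \<alpha>) \<beta>. v (\<alpha> \<union> \<beta>) - v \<alpha> - p \<beta>) ` (A1 \<times> Pow {l<..l'})"
        have finA': "finite A'" using finA1 by (simp add: A'_def)
        \<comment> \<open>The maps arising from the class of \<open>q\<close> have degree at most
          \<open>d\<close>; each becomes the representative of a class of degree
          \<open>d - 1\<close>. If \<open>d = 0\<close>, they vanish beyond \<open>l'\<close> and
          need no class.\<close>
        define K where "K = (if d = 0 then {#} else
          mset_set ((\<lambda>w. (d - 1, w)) ` {w \<in> A'. deg_le d l' w}))"
        define R' where "R' = image_mset (\<lambda>(e, q'). (e, \<lambda>\<beta>. q' \<beta> - p \<beta>)) R0 + K"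
        have "covered l' {w \<in> A'. \<not> deg_le 0 l' w} R'"
          unfolding covered_def
        proof (intro conjI ballI)
          have "deg_le (Suc e) l' (\<lambda>\<beta>. q' \<beta> - p \<beta>)" if "(e, q') \<in># R0" for e q'
          proof (rule deg_le_diff)
            show "deg_le (Suc e) l' q'"
              using that by (intro deg_le_mono_tail[OF degq l']) (simp add: R)
            show "deg_le (Suc e) l' p"
              using that by (intro deg_le_mono[OF deg_le_mono_tail[OF degv[OF dq p(2)] l']] )
                (auto simp: R intro: min)
          qed
          then show "case x of (e, q') \<Rightarrow> deg_le (Suc e) l' q'" if "x \<in># R'" for x
            using that finA' by (auto simp: R'_def K_def simp del: deg_le.simps split: if_splits)
        next
          fix w assume w: "w \<in> {w \<in> A'. \<not> deg_le 0 l' w}"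
          then obtain v \<alpha> where v: "v \<in> A1" "\<alpha> \<in> Pow {l<..l'}"
            and w_def: "w = (\<lambda>\<beta>. v (\<alpha> \<union> \<beta>) - v \<alpha> - p \<beta>)" by (auto simp: A'_def)
          obtain e q' where e: "(e, q') \<in># R" "deg_le e l (\<lambda>\<beta>. v \<beta> - q' \<beta>)"
            using cov v(1) by (auto simp: covered_def)
          note D = deg_le_derivative[OF degv[OF e] l' v(2)]
          \<comment> \<open>This difference is the derivative of \<open>v\<close> in direction
            \<alpha> plus \<open>v - q'\<close>.\<close>
          have "deg_le e l' (\<lambda>\<beta>. w \<beta> - (q' \<beta> - p \<beta>))"
            using deg_le_add[OF D deg_le_mono_tail[OF e(2) l']] by (simp add: w_def)
          show "\<exists>(e, q')\<in>#R'. deg_le e l' (\<lambda>\<beta>. w \<beta> - q' \<beta>)"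
          proof (cases "(e, q') \<in># R0")
            case True
            then have "(e, \<lambda>\<beta>. q' \<beta> - p \<beta>) \<in># R'" by (force simp: R'_def)
            with \<open>deg_le e l' (\<lambda>\<beta>. w \<beta> - (q' \<beta> - p \<beta>))\<close> show ?thesis 
              by (intro bexI[of _ "(e, \<lambda>\<beta>. q' \<beta> - p \<beta>)"]) simp_all
          next
            case False
            with e(1) have eq: "e = d" "q' = q" by (auto simp: R)
            \<comment> \<open>\<open>w\<close> is the difference of \<open>w - (q - p)\<close> and
              \<open>p - q\<close>.\<close>
            have dw: "deg_le d l' w"
              using deg_le_diff[OF \<open>deg_le e l' (\<lambda>\<beta>. w \<beta> - (q' \<beta> - p \<beta>))\<close>[unfolded eq]
                  deg_le_mono_tail[OF p(2) l']] by simp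
            with w have "d \<noteq> 0" by (metis (no_types, lifting) mem_Collect_eq)
            then have "(d - 1, w) \<in># R'" using dw w finA' by (auto simp: R'_def K_def simp del: deg_le.simps)
            moreover have "deg_le (d - 1) l' (\<lambda>\<beta>. w \<beta> - w \<beta>)" using deg_le_zero by simp
            ultimately show ?thesis by (intro bexI[of _ "(d - 1, w)"]) simp_all
          qed
        qed
        moreover have "(image_mset fst R', image_mset fst R) \<in> mult1 less_than"
        proof (rule mult1I[of _ d _ _ "image_mset fst K"])
          show "image_mset fst R' = image_mset fst R0 + image_mset fst K"
            by (simp add: R'_def image_mset.compositionality comp_def case_prod_unfold)
        qed (use finA' in \<open>auto simp: R K_def split: if_splits\<close>)
        ultimately show "recurrent l' A'" using 1(1) finA' by blast
      qed
    qed
  qed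
  \<comment> \<open>The maps of degree 0 are put back: they are 0 at every set occurring in
    \<open>D\<close>.\<close>
  have "\<exists>(a, \<beta>)\<in>D. \<forall>v\<in>A. c (a + v \<beta>) = c a"
    if "D \<subseteq> UNIV \<times> (fin_above l - {{}})" "\<exists>(a, \<beta>)\<in>D. \<forall>v\<in>A1. c (a + v \<beta>) = c a"
    for D and c :: "int \<Rightarrow> nat"
  proof -
    from that(2) obtain a \<beta> where *: "(a, \<beta>) \<in> D" "\<forall>v\<in>A1. c (a + v \<beta>) = c a" by blast
    have "\<beta> \<in> fin_above l" using that(1) *(1) by auto
    then have "c (a + v \<beta>) = c a" if "v \<in> A" for v
      using that *(2) by (cases "v \<in> A1") (auto simp: A1_def)
    with *(1) show ?thesis by blast
  qed
  with \<open>recurrent l A1\<close> show ?case unfolding recurrent_def by meson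
qed

lemma recurrent_deg_le:
  assumes "finite A" and "\<And>v. v \<in> A \<Longrightarrow> \<exists>d. deg_le d l v"
  shows "recurrent l A"
proof -
  from assms(2) obtain d where d: "\<And>v. v \<in> A \<Longrightarrow> deg_le (d v) l v" by metis
  show ?thesis
  proof (rule recurrent_covered[OF assms(1)])
    \<comment> \<open>Initially each map represents its own class.\<close>
    have "\<exists>(e, q)\<in>#mset_set ((\<lambda>v. (d v, v)) ` A). deg_le e l (\<lambda>\<beta>. v \<beta> - q \<beta>)" if "v \<in> A" for v
      using that assms(1) by (intro bexI[of _ "(d v, v)"]) (auto simp: deg_le_zero)
    then show "covered l {v \<in> A. \<not> deg_le 0 l v} (mset_set ((\<lambda>v. (d v, v)) ` A))"
      using assms(1) d by (auto simp: covered_def simp del: deg_le.simps intro: deg_le_Suc)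
  qed
qed

section \<open>Polynomials of finite sums as maps of bounded degree\<close>

lemma deg_le_cong:
  assumes "deg_le d l v" "\<And>\<beta>. \<beta> \<in> fin_above l \<Longrightarrow> v \<beta> = w \<beta>"
  shows "deg_le d l w"
proof -
  \<comment> \<open>Only values beyond \<open>l\<close> matter: the difference has degree 0, hence
    any larger degree.\<close>
  have "deg_le 0 l (\<lambda>\<beta>. w \<beta> - v \<beta>)" using assms(2) by simp
  then have "deg_le d l (\<lambda>\<beta>. w \<beta> - v \<beta>)" by (rule deg_le_mono) simp
  from deg_le_add[OF this assms(1)] show ?thesis by simp
qed

lemma deg_le_poly:
  fixes P :: "int poly" and f :: "nat \<Rightarrow> nat"
  assumes "coeff P 0 = 0" "degree P \<le> d"
  shows "deg_le d l (\<lambda>\<beta>. poly P (int (sum f \<beta>)))"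
  using assms
proof (induction d arbitrary: l P)
  case 0
  then have "P = 0" by (metis degree_eq_zeroE coeff_pCons_0 le_zero_eq pCons_0_0)
  then show ?case by (simp add: fin_above_def)
next
  case (Suc d)
  have "deg_le d l' (\<lambda>\<beta>. poly P (int (sum f (\<alpha> \<union> \<beta>))) - poly P (int (sum f \<alpha>)) - poly P (int (sum f \<beta>)))"
    if "l \<le> l'" "\<alpha> \<in> Pow {l<..l'}" for l' \<alpha>
  proof -
    define x where "x = int (sum f \<alpha>)"
    \<comment> \<open>\<open>Q\<close> is the defect of additivity of \<open>P\<close> at
      \<open>x\<close>. The top terms of \<open>P (x + y)\<close> and \<open>P y\<close> cancel,
      which lowers the degree bound by one.\<close>
    define Q where "Q = pcompose P [:x, 1:] - [:poly P x:] - P"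
    have Q: "poly Q y = poly P (x + y) - poly P x - poly P y" for y
      by (simp add: Q_def poly_pcompose)
    have "coeff Q 0 = 0" using Q[of 0] Suc.prems(1) by (simp add: poly_0_coeff_0)
    moreover have "degree Q \<le> d"
    proof (rule degree_le, intro allI impI)
      fix i assume "d < i"
      then have "coeff [:poly P x:] i = 0" by (simp add: coeff_pCons split: nat.split)
      moreover have "coeff (pcompose P [:x, 1:]) i = coeff P i"
      proof (cases "i = degree P")
        case True
        then show ?thesis using lead_coeff_comp[of "[:x, 1:]" P] by (simp add: degree_pcompose)
      next
        case False
        with \<open>d < i\<close> Suc.prems(2) have "degree P < i" by simp
        then show ?thesis by (simp add: coeff_eq_0 degree_pcompose)
      qed
      ultimately show "coeff Q i = 0" by (simp add: Q_def)
    qed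
    ultimately have "deg_le d l' (\<lambda>\<beta>. poly Q (int (sum f \<beta>)))" by (rule Suc.IH)
    moreover have "poly Q (int (sum f \<beta>)) =
        poly P (int (sum f (\<alpha> \<union> \<beta>))) - poly P (int (sum f \<alpha>)) - poly P (int (sum f \<beta>))"
      if "\<beta> \<in> fin_above l'" for \<beta>
    proof -
      have "sum f (\<alpha> \<union> \<beta>) = sum f \<alpha> + sum f \<beta>"
      proof (rule sum.union_disjoint)
        show "finite \<alpha>" using \<open>\<alpha> \<in> _\<close> finite_subset[of \<alpha> "{l<..l'}"] by simp
        show "\<alpha> \<inter> \<beta> = {}" using \<open>\<alpha> \<in> _\<close> that by (force simp: fin_above_def)
      qed (use that in \<open>simp add: fin_above_def\<close>)
      then show ?thesis by (simp add: Q x_def)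
    qed
    ultimately show ?thesis by (rule deg_le_cong)
  qed
  moreover have "poly P 0 = 0" using Suc.prems by (simp add: poly_0_coeff_0)
  ultimately show ?case by simp
qed

section \<open>The ideal of ultrafilters of Jp-sets\<close>

lemma polynomial_van_der_Waerden:
  fixes c :: "nat \<Rightarrow> nat"
  assumes F: "F \<in> Pf int_polys0" and H: "H \<in> Pf pos_seqs" and c: "finite (range c)"
  shows "\<exists>a\<in>pos_nats. \<exists>\<beta>\<in>Pf pos_nats. \<forall>P\<in>F. \<forall>f\<in>H.
    \<exists>y\<in>pos_nats. int y = int a + poly P (int (\<Sum>t\<in>\<beta>. f t)) \<and> c y = c a"
proof -
  define A where "A = (\<lambda>(P, f) \<beta>. poly P (int (\<Sum>t\<in>\<beta>. f t))) ` (F \<times> H)"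
  have "finite A" using F H by (simp add: A_def Pf_def)
  moreover have "\<exists>d. deg_le d 0 v" if "v \<in> A" for v
  proof -
    from that obtain P f where "P \<in> F" and v: "v = (\<lambda>\<beta>. poly P (int (\<Sum>t\<in>\<beta>. f t)))"
      by (auto simp: A_def)
    then have "coeff P 0 = 0" using F by (auto simp: Pf_def int_polys0_def)
    then show ?thesis unfolding v by (intro exI[of _ "degree P"] deg_le_poly order_refl)
  qed
  ultimately have "recurrent 0 A" by (rule recurrent_deg_le)
  from this[unfolded recurrent_def, rule_format, OF c]
  obtain D where finD: "finite D" and D: "D \<subseteq> UNIV \<times> (fin_above 0 - {{}})"
    and Dc: "\<And>c'. range c' \<subseteq> range c \<Longrightarrow> \<exists>(a, \<beta>)\<in>D. \<forall>v\<in>A. c' (a + v \<beta>) = c' a"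
    by (elim exE conjE) (rule that, auto)
  \<comment> \<open>\<open>V\<close> contains every point that \<open>D\<close> can produce. As
    \<open>D\<close> is independent of the colouring, a shift making all of \<open>V\<close>
    positive may enter the colouring to which \<open>D\<close> is applied.\<close>
  define V where "V = fst ` D \<union> (\<lambda>((a, \<beta>), v). a + v \<beta>) ` (D \<times> A)"
  have "finite V" using finD \<open>finite A\<close> by (simp add: V_def)
  define s where "s = 1 + Max (uminus ` V)"
  have s: "x + s \<ge> 1" if "x \<in> V" for x
  proof -
    have "- x \<le> Max (uminus ` V)" using that \<open>finite V\<close> by (intro Max_ge) auto
    then show ?thesis by (simp add: s_def)
  qed
  have "range (\<lambda>x. c (nat (x + s))) \<subseteq> range c" by auto
  from Dc[OF this] obtain a \<beta> where a: "(a, \<beta>) \<in> D"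
    and eq: "\<And>v. v \<in> A \<Longrightarrow> c (nat (a + v \<beta> + s)) = c (nat (a + s))" by blast
  have "a \<in> V" using a by (force simp: V_def)
  show ?thesis
  proof (rule bexI[of _ "nat (a + s)"], rule bexI[of _ \<beta>], intro ballI)
    fix P f assume "P \<in> F" "f \<in> H"
    define v where "v = (\<lambda>\<beta>. poly P (int (\<Sum>t\<in>\<beta>. f t)))"
    have "v \<in> A" using \<open>P \<in> F\<close> \<open>f \<in> H\<close> by (auto simp: A_def v_def)
    then have "a + v \<beta> \<in> V" using a by (force simp: V_def)
    then show "\<exists>y\<in>pos_nats. int y = int (nat (a + s)) + poly P (int (\<Sum>t\<in>\<beta>. f t)) \<and> c y = c (nat (a + s))"
      using s[OF \<open>a \<in> V\<close>] s[of "a + v \<beta>"] eq[OF \<open>v \<in> A\<close>]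
      by (intro bexI[of _ "nat (a + v \<beta> + s)"]) (auto simp: v_def)
  next
    show "nat (a + s) \<in> pos_nats" using s[OF \<open>a \<in> V\<close>] by simp
    have "\<beta> \<in> fin_above 0 - {{}}" using a D by blast
    then show "\<beta> \<in> Pf pos_nats" by (auto simp: Pf_def fin_above_def subset_eq Suc_le_eq)
  qed
qed

section \<open>Existence of ultrafilters consisting of Jp-sets\<close>

text \<open>The order on filters makes finer filters smaller, so Zorn's lemma is applied to the
  reversed order and yields a minimal proper filter.\<close>

lemma ultrafilter_below:
  assumes "F \<noteq> bot"
  shows "\<exists>p\<le>F. ultrafilter p"
proof -
  define S where "S = {G. G \<noteq> bot \<and> G \<le> F}"
  have "\<exists>m\<in>S. \<forall>G\<in>S. G \<le> m \<longrightarrow> G = m"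
  proof (rule predicate_Zorn)
    show "partial_order_on S (relation_of (\<lambda>x y. y \<le> x) S)"
      by (rule partial_order_on_relation_ofI) auto
  next
    fix C assume "C \<in> Chains (relation_of (\<lambda>x y. y \<le> x) S)"
    then have C: "C \<subseteq> S" and lin: "\<And>x y. x \<in> C \<Longrightarrow> y \<in> C \<Longrightarrow> x \<le> y \<or> y \<le> x"
      by (auto simp: Chains_def relation_of_def)
    show "\<exists>u\<in>S. \<forall>a\<in>C. u \<le> a"
    proof (cases "C = {}")
      case True
      then show ?thesis using assms by (auto simp: S_def)
    next
      case False
      \<comment> \<open>Along a chain the infimum is the union of the filters, so it remains
        proper.\<close>
      have "eventually P (Inf C) \<longleftrightarrow> (\<exists>b\<in>C. eventually P b)" for P
        by (rule eventually_Inf_base[OF False]) (use lin in \<open>metis inf.absorb1 inf.absorb2 order_refl\<close>)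
      then have "Inf C \<noteq> bot" using C by (auto simp: trivial_limit_def S_def)
      moreover have "Inf C \<le> F" using False C by (auto simp: S_def intro: Inf_lower2)
      ultimately show ?thesis by (auto simp: S_def intro!: bexI[of _ "Inf C"] Inf_lower)
    qed
  qed
  then obtain m where m: "m \<in> S" "\<And>G. G \<in> S \<Longrightarrow> G \<le> m \<Longrightarrow> G = m" by blast
  have "(\<forall>\<^sub>F x in m. x \<in> A) \<or> (\<forall>\<^sub>F x in m. x \<notin> A)" for A
  proof (cases "inf m (principal A) = bot")
    case True
    then show ?thesis by (auto simp: trivial_limit_def eventually_inf_principal)
  next
    case False
    then have "inf m (principal A) \<in> S" using m(1) by (auto simp: S_def intro: le_infI1)
    then have "inf m (principal A) = m" using m(2) by simp
    then have "m \<le> principal A" by (simp add: inf.absorb_iff1)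
    then show ?thesis by (simp add: le_principal)
  qed
  then show ?thesis using m(1) by (auto simp: S_def ultrafilter_def)
qed

lemma Pf_UN:
  assumes "finite X" "X \<noteq> {}" "\<And>B. B \<in> X \<Longrightarrow> G B \<in> Pf Y"
  shows "\<Union>(G ` X) \<in> Pf Y"
proof -
  have "G B \<subseteq> Y" "finite (G B)" "G B \<noteq> {}" if "B \<in> X" for B
    using assms(3)[OF that] by (auto simp: Pf_def)
  then have "\<Union>(G ` X) \<subseteq> Y" "finite (\<Union>(G ` X))" "\<Union>(G ` X) \<noteq> {}"
    using assms(1,2) by (intro UN_least finite_UN_I, auto)
  then show ?thesis by (simp add: Pf_def)
qed

text \<open>If every cell failed, polynomial van der Waerden for the colouring by cells and the
  unions of all the failing families would refute the failure of the cell of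
  \<open>a\<close>.\<close>

lemma Jp_set_in_finite_cover:
  assumes "finite X" "pos_nats \<subseteq> \<Union>X" "\<And>B. B \<in> X \<Longrightarrow> B \<subseteq> pos_nats"
  shows "\<exists>B\<in>X. Jp_set B"
proof (rule ccontr)
  assume "\<not> (\<exists>B\<in>X. Jp_set B)"
  define good where "good F H B \<longleftrightarrow> (\<exists>a\<in>pos_nats. \<exists>\<beta>\<in>Pf pos_nats. \<forall>P\<in>F. \<forall>f\<in>H.
    int a + poly P (int (\<Sum>t\<in>\<beta>. f t)) \<in> int ` B)" for F H B
  have "Jp_set B \<longleftrightarrow> (\<forall>F\<in>Pf int_polys0. \<forall>H\<in>Pf pos_seqs. good F H B)" if "B \<in> X" for B
    using assms(3)[OF that] by (simp add: Jp_set_def good_def)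
  with \<open>\<not> (\<exists>B\<in>X. Jp_set B)\<close>
  have "\<forall>B\<in>X. \<exists>F H. F \<in> Pf int_polys0 \<and> H \<in> Pf pos_seqs \<and> \<not> good F H B" by blast
  then obtain F H where F: "\<And>B. B \<in> X \<Longrightarrow> F B \<in> Pf int_polys0"
    and H: "\<And>B. B \<in> X \<Longrightarrow> H B \<in> Pf pos_seqs"
    and none: "\<And>B. B \<in> X \<Longrightarrow> \<not> good (F B) (H B) B" by metis
  have "X \<noteq> {}" using assms(2) by auto
  note UN = Pf_UN[OF assms(1) \<open>X \<noteq> {}\<close>]
  have "\<Union>(F ` X) \<in> Pf int_polys0" by (rule UN[OF F])
  moreover have "\<Union>(H ` X) \<in> Pf pos_seqs" by (rule UN[OF H])
  moreover obtain g :: "nat set \<Rightarrow> nat" where g: "inj_on g X"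
    using finite_imp_inj_to_nat_seg[OF assms(1)] by metis
  \<comment> \<open>The colouring must be total; at 0 any cell is taken.\<close>
  have "\<forall>x. \<exists>B\<in>X. x \<in> pos_nats \<longrightarrow> x \<in> B" using assms(2) \<open>X \<noteq> {}\<close> by blast
  then obtain cell where cell: "\<And>x. cell x \<in> X" "\<And>x. x \<in> pos_nats \<Longrightarrow> x \<in> cell x" by metis
  have "finite (range (\<lambda>x. g (cell x)))"
    by (rule finite_subset[of _ "g ` X"]) (use cell assms(1) in auto)
  ultimately obtain a \<beta> where a: "a \<in> pos_nats" "\<beta> \<in> Pf pos_nats"
    and mono: "\<And>P f. P \<in> \<Union>(F ` X) \<Longrightarrow> f \<in> \<Union>(H ` X) \<Longrightarrow>
      \<exists>y\<in>pos_nats. int y = int a + poly P (int (\<Sum>t\<in>\<beta>. f t)) \<and> g (cell y) = g (cell a)"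
    using polynomial_van_der_Waerden by meson
  have "int a + poly P (int (\<Sum>t\<in>\<beta>. f t)) \<in> int ` cell a" if "P \<in> F (cell a)" "f \<in> H (cell a)" for P f
  proof -
    from that mono[of P f] cell(1) obtain y where "y \<in> pos_nats"
      "int y = int a + poly P (int (\<Sum>t\<in>\<beta>. f t))" "g (cell y) = g (cell a)" by blast
    moreover from this have "cell y = cell a" using g cell(1) by (blast dest: inj_onD)
    ultimately show ?thesis using cell(2)[of y] by (metis image_eqI)
  qed
  with a have "good (F (cell a)) (H (cell a)) (cell a)" unfolding good_def by blast
  with none[OF cell(1)] show False by blast
qed

text \<open>By the covering lemma the complements of the sets that are not Jp-sets have the finite
  intersection property. An ultrafilter containing them all has only Jp-sets as members.\<close>

lemma Jp_nonempty: "Jp \<noteq> {}"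
proof -
  define N where "N = {B. B \<subseteq> pos_nats \<and> \<not> Jp_set B}"
  have "(INF B\<in>N. principal (pos_nats - B)) \<noteq> bot"
  proof (rule INF_filter_not_bot)
    fix X assume X: "X \<subseteq> N" "finite X"
    show "(INF B\<in>X. principal (pos_nats - B)) \<noteq> bot"
    proof (cases "X = {}")
      case False
      have "\<not> pos_nats \<subseteq> \<Union>X" using Jp_set_in_finite_cover[OF X(2)] X(1) by (auto simp: N_def)
      then show ?thesis using False by (auto simp: INF_principal_finite[OF X(2)] principal_eq_bot_iff)
    qed (simp add: trivial_limit_def)
  qed
  then obtain p where p: "p \<le> (INF B\<in>N. principal (pos_nats - B))" "ultrafilter p"
    using ultrafilter_below by blast
  have ev: "\<forall>\<^sub>F x in p. x \<in> pos_nats - B" if "B \<in> N" for B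
    using order_trans[OF p(1) INF_lower[OF that]] by (simp add: le_principal)
  \<comment> \<open>The complement of the empty set puts the positive integers into
    \<open>p\<close>.\<close>
  have "\<not> Jp_set {}"
  proof
    assume "Jp_set {}"
    moreover have "{0} \<in> Pf int_polys0" by (simp add: Pf_def int_polys0_def)
    moreover have "{restrict (\<lambda>_. 1) pos_nats} \<in> Pf pos_seqs" by (auto simp: Pf_def)
    ultimately show False unfolding Jp_set_def by blast
  qed
  then have "{} \<in> N" by (simp add: N_def)
  from ev[OF this] have "p \<in> beta_N" using p(2) by (simp add: beta_N_def)
  moreover have "Jp_set B" if "B \<subseteq> pos_nats" "\<forall>\<^sub>F x in p. x \<in> B" for B
  proof (rule ccontr)
    assume "\<not> Jp_set B"
    with that(1) have "\<forall>\<^sub>F x in p. x \<notin> B" using ev[of B] by (auto simp: N_def elim: eventually_mono)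
    then show False using that(2) ultrafilter_not_eventually[OF p(2)] by blast
  qed
  ultimately show ?thesis by (auto simp: Jp_def)
qed

section \<open>Jp is a two-sided ideal\<close>

lemma ultrafilter_eventually_ex:
  assumes "ultrafilter p" "\<forall>\<^sub>F x in p. P x"
  shows "\<exists>x. P x"
  using assms by (auto simp: ultrafilter_def intro: eventually_happens')

lemma Jp_set_of_eventually:
  assumes "q \<in> Jp" "\<forall>\<^sub>F x in q. P x"
  shows "Jp_set {x \<in> pos_nats. P x}"
proof -
  have "\<forall>\<^sub>F x in q. x \<in> pos_nats" using assms(1) by (simp add: Jp_def beta_N_def)
  with assms(2) have "\<forall>\<^sub>F x in q. x \<in> {x \<in> pos_nats. P x}" by eventually_elim simp
  moreover have "{x \<in> pos_nats. P x} \<subseteq> pos_nats" by blast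
  ultimately show ?thesis using assms(1) unfolding Jp_def by blast
qed

text \<open>For \<open>p \<oplus>\<^sub>\<beta> q\<close> one translate \<open>x\<close> is absorbed
  into \<open>a\<close>. For \<open>q \<oplus>\<^sub>\<beta> p\<close> a single \<open>y\<close>
  must suit all values at once; it exists because \<open>F\<close> and \<open>H\<close> are
  finite.\<close>

lemma uf_ideal_Jp: "uf_ideal Jp"
  unfolding uf_ideal_def
proof (intro conjI ballI Jp_nonempty)
  show "Jp \<subseteq> beta_N" by (auto simp: Jp_def)
next
  fix p q assume p: "p \<in> beta_N" and q: "q \<in> Jp"
  then have q': "q \<in> beta_N" and up: "ultrafilter p"
    by (auto simp: Jp_def beta_N_def)
  have "Jp_set A" if A: "A \<subseteq> pos_nats" "\<forall>\<^sub>F x in p \<oplus>\<^sub>\<beta> q. x \<in> A" for A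
  proof -
    have "\<forall>\<^sub>F x in p. \<forall>\<^sub>F y in q. x + y \<in> A" using A(2) by (simp add: eventually_uf_add)
    with ultrafilter_eventually_ex[OF up] obtain x where "\<forall>\<^sub>F y in q. x + y \<in> A" by blast
    from Jp_set_of_eventually[OF q this] have J: "Jp_set {y \<in> pos_nats. x + y \<in> A}" .
    show ?thesis unfolding Jp_set_def
    proof (intro conjI A ballI)
      fix F H assume "F \<in> Pf int_polys0" "H \<in> Pf pos_seqs"
      with J obtain a \<beta> where a: "a \<in> pos_nats" "\<beta> \<in> Pf pos_nats"
        and *: "\<forall>P\<in>F. \<forall>f\<in>H. int a + poly P (int (\<Sum>t\<in>\<beta>. f t)) \<in> int ` {y \<in> pos_nats. x + y \<in> A}"
        unfolding Jp_set_def by meson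
      have "int (x + a) + poly P (int (\<Sum>t\<in>\<beta>. f t)) \<in> int ` A" if Pf: "P \<in> F" "f \<in> H" for P f
      proof -
        from * Pf obtain y where "int a + poly P (int (\<Sum>t\<in>\<beta>. f t)) = int y" "x + y \<in> A" by blast
        then show ?thesis by (intro image_eqI[of _ _ "x + y"]) auto
      qed
      with a show "\<exists>a\<in>pos_nats. \<exists>\<beta>\<in>Pf pos_nats. \<forall>P\<in>F. \<forall>f\<in>H.
          int a + poly P (int (\<Sum>t\<in>\<beta>. f t)) \<in> int ` A"
        by (intro bexI[of _ "x + a"] bexI[of _ \<beta>]) auto
    qed
  qed
  then show "p \<oplus>\<^sub>\<beta> q \<in> Jp" using uf_add_closed[OF p q'] by (simp add: Jp_def)
  have "Jp_set A" if A: "A \<subseteq> pos_nats" "\<forall>\<^sub>F x in q \<oplus>\<^sub>\<beta> p. x \<in> A" for A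
  proof -
    have "\<forall>\<^sub>F x in q. \<forall>\<^sub>F y in p. x + y \<in> A" using A(2) by (simp add: eventually_uf_add)
    from Jp_set_of_eventually[OF q this] have J: "Jp_set {x \<in> pos_nats. \<forall>\<^sub>F y in p. x + y \<in> A}" .
    show ?thesis unfolding Jp_set_def
    proof (intro conjI A ballI)
      fix F H assume FH: "F \<in> Pf int_polys0" "H \<in> Pf pos_seqs"
      with J obtain a \<beta> where a: "a \<in> pos_nats" "\<beta> \<in> Pf pos_nats"
        and *: "\<forall>P\<in>F. \<forall>f\<in>H. int a + poly P (int (\<Sum>t\<in>\<beta>. f t)) \<in> int ` {x \<in> pos_nats. \<forall>\<^sub>F y in p. x + y \<in> A}"
        unfolding Jp_set_def by meson
      have "\<forall>\<^sub>F y in p. int (a + y) + poly P (int (\<Sum>t\<in>\<beta>. f t)) \<in> int ` A" if Pf: "P \<in> F" "f \<in> H" for P f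
      proof -
        from * Pf obtain x where x: "int a + poly P (int (\<Sum>t\<in>\<beta>. f t)) = int x" "\<forall>\<^sub>F y in p. x + y \<in> A" by blast
        from x(2) show ?thesis
        proof eventually_elim
          fix y assume "x + y \<in> A"
          then show "int (a + y) + poly P (int (\<Sum>t\<in>\<beta>. f t)) \<in> int ` A"
            using x(1) by (intro image_eqI[of _ _ "x + y"]) auto
        qed
      qed
      then have "\<forall>\<^sub>F y in p. \<forall>P\<in>F. \<forall>f\<in>H. int (a + y) + poly P (int (\<Sum>t\<in>\<beta>. f t)) \<in> int ` A"
        using FH by (auto simp: Pf_def intro!: eventually_ball_finite)
      with ultrafilter_eventually_ex[OF up] obtain y where
        "\<forall>P\<in>F. \<forall>f\<in>H. int (a + y) + poly P (int (\<Sum>t\<in>\<beta>. f t)) \<in> int ` A" by blast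
      with a show "\<exists>a\<in>pos_nats. \<exists>\<beta>\<in>Pf pos_nats. \<forall>P\<in>F. \<forall>f\<in>H.
          int a + poly P (int (\<Sum>t\<in>\<beta>. f t)) \<in> int ` A"
        by (intro bexI[of _ "a + y"] bexI[of _ \<beta>]) auto
    qed
  qed
  then show "q \<oplus>\<^sub>\<beta> p \<in> Jp" using uf_add_closed[OF q' p] by (simp add: Jp_def)
qed

lemma minimal_idempotent_Jp: "minimal_idempotent p \<Longrightarrow> p \<in> Jp"
  using uf_ideal_Jp by (auto simp: minimal_idempotent_def K_beta_N_def)

section \<open>The recursive construction\<close>

text \<open>The iterated quantifier becomes a tree in which p-almost every extension of an inner
  node is a node, so coordinates can be chosen one at a time.\<close>

lemma tensor_tree:
  assumes "m \<ge> 1" "\<forall>\<^sub>F xs in tensor (\<lambda>_. p) m. xs \<in> A"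
  shows "\<exists>D. [] \<in> D \<and> (\<forall>xs\<in>D. length xs < m \<longrightarrow> (\<forall>\<^sub>F x in p. xs @ [x] \<in> D)) \<and>
    (\<forall>xs\<in>D. length xs = m \<longrightarrow> xs \<in> A)"
  using assms
proof (induction m arbitrary: A rule: dec_induct)
  case base
  then have "\<forall>\<^sub>F x in p. [x] \<in> A" using eventually_tensor_1[where p = "\<lambda>_. p" and A = A] by simp
  then show ?case by (intro exI[of _ "insert [] A"]) auto
next
  case (step m)
  from step.prems step.hyps(1) have "\<forall>\<^sub>F xs in tensor (\<lambda>_. p) m. xs \<in> {xs. \<forall>\<^sub>F x in p. xs @ [x] \<in> A}"
    by (simp add: eventually_tensor_Suc)
  from step.IH[OF this] obtain D where D: "[] \<in> D"
    "\<And>xs. xs \<in> D \<Longrightarrow> length xs < m \<Longrightarrow> \<forall>\<^sub>F x in p. xs @ [x] \<in> D"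
    "\<And>xs. xs \<in> D \<Longrightarrow> length xs = m \<Longrightarrow> \<forall>\<^sub>F x in p. xs @ [x] \<in> A" by blast
  \<comment> \<open>The induction hypothesis does not control lists longer than \<open>m\<close>, so
    \<open>D\<close> is cut off there before the new leaves are added.\<close>
  define D' where "D' = {xs \<in> D. length xs \<le> m} \<union> {xs \<in> A. length xs = Suc m}"
  have "\<forall>\<^sub>F x in p. xs @ [x] \<in> D'" if "xs \<in> D'" "length xs < Suc m" for xs
  proof (cases "length xs < m")
    case True
    with that D(2)[of xs] show ?thesis by (auto simp: D'_def elim: eventually_mono)
  next
    case False
    with that D(3)[of xs] show ?thesis by (auto simp: D'_def elim: eventually_mono)
  qed
  moreover have "[] \<in> D'" "\<forall>xs\<in>D'. length xs = Suc m \<longrightarrow> xs \<in> A" using D(1) by (auto simp: D'_def)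
  ultimately show ?case by blast
qed

section \<open>Star sets and the states of partially built tuples\<close>

locale polynomial_central =
  fixes p :: "nat filter" and D :: "nat list set" and m :: nat and T :: "int poly set"
  assumes idem: "uf_idempotent p" and Jp: "p \<in> Jp" and m: "m \<ge> 1"
    and root: "[] \<in> D" and branch: "\<And>xs. xs \<in> D \<Longrightarrow> length xs < m \<Longrightarrow> \<forall>\<^sub>F x in p. xs @ [x] \<in> D"
    and T: "T \<in> Pf int_polys0"
begin

lemma eventually_idem: "(\<forall>\<^sub>F x in p. P x) \<longleftrightarrow> (\<forall>\<^sub>F x in p. \<forall>\<^sub>F y in p. P (x + y))"
  using idem eventually_uf_add[of P p p] by (simp add: uf_idempotent_def)

text \<open>\<open>z\<close> lies in the star set of \<open>{n. xs @ [n] \<in> D}\<close>.\<close>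

definition in_star :: "nat list \<Rightarrow> int \<Rightarrow> bool" where
  "in_star xs z \<longleftrightarrow> (\<exists>n\<ge>1. z = int n \<and> xs @ [n] \<in> D \<and> (\<forall>\<^sub>F x in p. xs @ [n + x] \<in> D))"

lemma eventually_pos: "\<forall>\<^sub>F x in p. x \<ge> 1"
  using idem by (simp add: uf_idempotent_def beta_N_def)

lemma eventually_in_star:
  assumes "xs \<in> D" "length xs < m"
  shows "\<forall>\<^sub>F x in p. in_star xs (int x)"
proof -
  have "\<forall>\<^sub>F x in p. xs @ [x] \<in> D" using branch assms by blast
  moreover from this have "\<forall>\<^sub>F x in p. \<forall>\<^sub>F y in p. xs @ [x + y] \<in> D" by (subst (asm) eventually_idem)
  ultimately show ?thesis using eventually_pos by eventually_elim (auto simp: in_star_def)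
qed

text \<open>Idempotence turns the condition on \<open>n + x\<close> into one on
  \<open>n + x + y\<close>, which is the star condition at \<open>n + x\<close>.\<close>

lemma eventually_in_star_add:
  assumes "in_star xs z"
  shows "\<forall>\<^sub>F x in p. in_star xs (z + int x)"
proof -
  from assms obtain n where n: "n \<ge> 1" "z = int n" "\<forall>\<^sub>F x in p. xs @ [n + x] \<in> D"
    by (auto simp: in_star_def)
  from n(3) have "\<forall>\<^sub>F x in p. \<forall>\<^sub>F y in p. xs @ [n + (x + y)] \<in> D" by (subst (asm) eventually_idem)
  with n(3) show ?thesis
  proof eventually_elim
    fix x assume "xs @ [n + x] \<in> D" "\<forall>\<^sub>F y in p. xs @ [n + (x + y)] \<in> D"
    then show "in_star xs (z + int x)" unfolding in_star_def using n
      by (intro exI[of _ "n + x"]) (auto simp: add_ac)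
  qed
qed

text \<open>States that arise from chains with last set \<open>K\<close>: the completed entries, and the \<open>\<alpha>\<close>-sum, the
  polynomial and its argument for the current entry. An \<open>\<alpha>\<close>-sum \<open>0\<close> marks an entry not yet begun.\<close>

inductive reach :: "((nat \<Rightarrow> nat) set \<Rightarrow> nat \<times> nat set) \<Rightarrow> (nat \<Rightarrow> nat) set \<Rightarrow>
    nat list \<times> nat \<times> int poly \<times> nat \<Rightarrow> bool" for \<phi> where
  start: "P \<in> T \<Longrightarrow> reach \<phi> {} ([], 0, P, 0)"
| step: "reach \<phi> K (xs, s, P, y) \<Longrightarrow> K \<subset> G \<Longrightarrow> f \<in> G \<Longrightarrow>
    reach \<phi> G (xs, s + fst (\<phi> G), P, y + (\<Sum>t\<in>snd (\<phi> G). f t))"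
| close: "reach \<phi> K (xs, s, P, y) \<Longrightarrow> s > 0 \<Longrightarrow> Suc (length xs) < m \<Longrightarrow> P' \<in> T \<Longrightarrow>
    reach \<phi> K (xs @ [nat (int s + poly P (int y))], 0, P', 0)"

text \<open>This locality makes it legitimate to define \<open>\<phi>\<close> by recursion on
  sets.\<close>

lemma reach_cong:
  assumes "reach \<phi> K c" "\<And>L. L \<subseteq> K \<Longrightarrow> \<phi> L = \<psi> L"
  shows "reach \<psi> K c"
  using assms
proof induction
  case (step K xs s P y G f)
  then have "reach \<psi> K (xs, s, P, y)" by blast
  from reach.step[OF this step.hyps(2,3)] show ?case using step.prems[of G] by simp
qed (auto intro: reach.intros)

text \<open>A state at \<open>K\<close> is a start or a step from a state at a proper subset,
  followed by at most one \<open>close\<close>: closing resets the sum to 0, and a further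
  \<open>close\<close> needs a positive sum.\<close>

lemma finite_reach:
  assumes "finite K"
  shows "finite {c. reach \<phi> K c}"
  using assms
proof (induction K rule: finite_psubset_induct)
  case (psubset K)
  define C where "C = (\<Union>L\<in>{L. L \<subset> K}. {c. reach \<phi> L c})"
  define S where "S = (\<lambda>P. ([], 0, P, 0)) ` T \<union>
    (\<lambda>((xs, s, P, y), f). (xs, s + fst (\<phi> K), P, y + (\<Sum>t\<in>snd (\<phi> K). f t))) ` (C \<times> K)"
  have finT: "finite T" using T by (simp add: Pf_def)
  have "{L. L \<subset> K} \<subseteq> Pow K" by blast
  then have "finite {L. L \<subset> K}" using psubset.hyps finite_subset by blast
  then have "finite C" unfolding C_def using psubset.IH by blast
  then have "finite S" unfolding S_def using finT psubset.hyps by blast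
  have "c \<in> S \<union> (\<lambda>((xs, s, P, y), P'). (xs @ [nat (int s + poly P (int y))], 0, P', 0)) ` (S \<times> T)"
    if "reach \<phi> K c" for c
    using that
  proof cases
    case (start P)
    then show ?thesis by (auto simp: S_def)
  next
    case (step L xs s P y f)
    then have "((xs, s, P, y), f) \<in> C \<times> K" by (auto simp: C_def)
    with step(1) have "c \<in> S" unfolding S_def by (intro UnI2) (rule rev_image_eqI, auto)
    then show ?thesis ..
  next
    case (close xs s P y P')
    from close(2) have "(xs, s, P, y) \<in> S"
    proof cases
      case (step L s' y' f)
      then have "((xs, s', P, y'), f) \<in> C \<times> K" by (auto simp: C_def)
      with step(1,2) show ?thesis unfolding S_def by (intro UnI2) (rule rev_image_eqI, auto)
    qed (use close(3) in auto)
    with close have "((xs, s, P, y), P') \<in> S \<times> T" by blast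
    with close(1) show ?thesis by (intro UnI2) (rule rev_image_eqI, auto)
  qed
  then have "{c. reach \<phi> K c} \<subseteq>
    S \<union> (\<lambda>((xs, s, P, y), P'). (xs @ [nat (int s + poly P (int y))], 0, P', 0)) ` (S \<times> T)" by blast
  moreover have "finite \<dots>" using \<open>finite S\<close> finT by blast
  ultimately show ?case by (rule finite_subset)
qed

text \<open>This is the requirement on the value at \<open>G\<close> relative to the values at
  proper subsets. It is vacuous outside the intended domain because \<open>\<phi>\<close> is total;
  the empty set carries no block but still supplies the initial states.\<close>

definition good :: "((nat \<Rightarrow> nat) set \<Rightarrow> nat \<times> nat set) \<Rightarrow> (nat \<Rightarrow> nat) set \<Rightarrow> nat \<times> nat set \<Rightarrow> bool" where
  "good \<phi> G r \<longleftrightarrow> (G \<in> Pf pos_seqs \<longrightarrow> fst r \<in> pos_nats \<and> snd r \<in> Pf pos_nats \<and>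
    (\<forall>K. K \<subset> G \<longrightarrow> K \<noteq> {} \<longrightarrow> block_less (snd (\<phi> K)) (snd r)) \<and>
    (\<forall>K xs s P y. K \<subset> G \<longrightarrow> reach \<phi> K (xs, s, P, y) \<longrightarrow>
      (\<forall>f\<in>G. in_star xs (int (s + fst r) + poly P (int (y + (\<Sum>t\<in>snd r. f t)))))))"

text \<open>An entry not yet begun has value 0, which is in no star set, hence the case
  distinction.\<close>

definition valid :: "nat list \<times> nat \<times> int poly \<times> nat \<Rightarrow> bool" where
  "valid = (\<lambda>(xs, s, P, y). xs \<in> D \<and> length xs < m \<and> P \<in> T \<and>
    (if s = 0 then y = 0 else in_star xs (int s + poly P (int y))))"

lemma valid_reach:
  assumes "reach \<phi> K c" "K \<subseteq> pos_seqs" "finite K" "\<And>L. L \<subseteq> K \<Longrightarrow> good \<phi> L (\<phi> L)"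
  shows "valid c"
  using assms
proof induction
  case (start P)
  then show ?case using root m by (simp add: valid_def)
next
  case (step K xs s P y G f)
  then have "valid (xs, s, P, y)" using finite_subset[of K G] by blast
  moreover have G: "G \<in> Pf pos_seqs" using step by (auto simp: Pf_def)
  moreover have "good \<phi> G (\<phi> G)" using step.prems by blast
  ultimately show ?case using step.hyps unfolding good_def by (auto simp: valid_def)
next
  case (close K xs s P y P')
  then have "valid (xs, s, P, y)" by blast
  with close.hyps have "in_star xs (int s + poly P (int y))" by (simp add: valid_def)
  with close.hyps show ?case by (auto simp: valid_def in_star_def)
qed

text \<open>An entry not yet begun has value 0 as \<open>P\<close> has no constant term, so this is
  the choice of a first value; otherwise the star property persists.\<close>

lemma valid_eventually:
  assumes "valid (xs, s, P, y)"
  shows "\<forall>\<^sub>F x in p. in_star xs (int s + poly P (int y) + int x)"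
proof (cases "s = 0")
  case True
  then have "poly P (int y) = 0"
    using assms T by (auto simp: valid_def Pf_def int_polys0_def poly_0_coeff_0)
  then show ?thesis using True assms eventually_in_star by (simp add: valid_def)
next
  case False
  then show ?thesis using assms eventually_in_star_add by (simp add: valid_def)
qed

text \<open>Finitely many states must be continued, so the increments suiting all of them form a
  member of \<open>p\<close>, hence a Jp-set, which supplies \<open>a\<close> and the block
  together.\<close>

lemma good_exists:
  assumes G: "G \<in> Pf pos_seqs" and sub: "\<And>K. K \<subset> G \<Longrightarrow> good \<phi> K (\<phi> K)"
  shows "\<exists>r. good \<phi> G r"
proof -
  have finG: "finite G" "G \<subseteq> pos_seqs" "G \<noteq> {}" using G by (auto simp: Pf_def)
  define C where "C = (\<Union>K\<in>{K. K \<subset> G}. {c. reach \<phi> K c})"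
  have finS: "finite {K. K \<subset> G}" using finG by (auto intro: finite_subset[of _ "Pow G"])
  then have finC: "finite C" unfolding C_def using finS finG
    by (intro finite_UN_I finite_reach) (auto intro: finite_subset)
  have validC: "valid c" if "c \<in> C" for c
  proof -
    from that obtain K where K: "K \<subset> G" "reach \<phi> K c" by (auto simp: C_def)
    show ?thesis
    proof (rule valid_reach[OF K(2)])
      show "K \<subseteq> pos_seqs" using K finG by blast
      show "finite K" using K finG finite_subset by blast
      show "good \<phi> L (\<phi> L)" if "L \<subseteq> K" for L using that K sub by blast
    qed
  qed
  \<comment> \<open>\<open>M\<close> bounds all earlier blocks; the inserted 0 covers the case that
    there are none.\<close>
  define M where "M = Max (insert 0 (\<Union>K\<in>{K. K \<subset> G \<and> K \<noteq> {}}. snd (\<phi> K)))"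
  have block: "snd (\<phi> K) \<in> Pf pos_nats" if "K \<subset> G" "K \<noteq> {}" for K
  proof -
    have "K \<in> Pf pos_seqs" using that finG finite_subset[of K G] by (auto simp: Pf_def)
    with sub[OF that(1)] show ?thesis by (simp add: good_def)
  qed
  have finU: "finite (\<Union>K\<in>{K. K \<subset> G \<and> K \<noteq> {}}. snd (\<phi> K))"
    using finS block by (auto simp: Pf_def)
  have M: "t \<le> M" if "K \<subset> G" "K \<noteq> {}" "t \<in> snd (\<phi> K)" for K t
    unfolding M_def using finU that by (intro Max_ge) auto
  define E where "E x \<longleftrightarrow> (\<forall>(xs, s, P, y)\<in>C. in_star xs (int s + poly P (int y) + int x))" for x
  have "\<forall>\<^sub>F x in p. E x" unfolding E_def
    using validC valid_eventually by (intro eventually_ball_finite finC) auto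
  then have JE: "Jp_set {x \<in> pos_nats. E x}" by (rule Jp_set_of_eventually[OF Jp])
  \<comment> \<open>For \<open>Q\<close> in \<open>F\<close>, adding \<open>a + Q u\<close> to
    \<open>s + P y\<close> gives \<open>s + a + P (y + u)\<close>.\<close>
  define F where "F = (\<lambda>(xs, s, P, y). pcompose P [:int y, 1:] - [:poly P (int y):]) ` C"
  obtain P0 where "P0 \<in> T" using T by (auto simp: Pf_def)
  then have "([], 0, P0, 0) \<in> C" using reach.start finG by (auto simp: C_def)
  moreover have "coeff (pcompose P [:int y, 1:] - [:poly P (int y):]) 0 = 0" for P :: "int poly" and y
    by (simp flip: poly_0_coeff_0 add: poly_pcompose)
  ultimately have F: "F \<in> Pf int_polys0" using finC by (auto simp: Pf_def F_def int_polys0_def)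
  \<comment> \<open>Applying the Jp property to shifted sequences and moving the block back by
    \<open>M\<close> places it beyond all earlier blocks.\<close>
  define shift :: "(nat \<Rightarrow> nat) \<Rightarrow> nat \<Rightarrow> nat" where "shift f = restrict (\<lambda>t. f (t + M)) pos_nats" for f
  have "shift f \<in> pos_seqs" if "f \<in> pos_seqs" for f
  proof -
    have "f (t + M) \<in> pos_nats" if "t \<in> pos_nats" for t using \<open>f \<in> pos_seqs\<close> that
      by (intro PiE_mem[of f pos_nats "\<lambda>_. pos_nats"]) auto
    then show ?thesis unfolding shift_def by (intro restrict_PiE_iff[THEN iffD2]) blast
  qed
  then have "shift ` G \<in> Pf pos_seqs" using finG by (auto simp: Pf_def)
  with JE F obtain a \<beta>' where a: "a \<in> pos_nats" and \<beta>': "\<beta>' \<in> Pf pos_nats"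
    and *: "\<And>Q f. Q \<in> F \<Longrightarrow> f \<in> shift ` G \<Longrightarrow>
      int a + poly Q (int (\<Sum>t\<in>\<beta>'. f t)) \<in> int ` {x \<in> pos_nats. E x}"
    unfolding Jp_set_def by meson
  define \<beta> where "\<beta> = (\<lambda>t. t + M) ` \<beta>'"
  have \<beta>: "\<beta> \<in> Pf pos_nats" using \<beta>' by (auto simp: \<beta>_def Pf_def)
  have sum_shift: "(\<Sum>t\<in>\<beta>'. shift f t) = (\<Sum>t\<in>\<beta>. f t)" for f
  proof -
    have "(\<Sum>t\<in>\<beta>'. shift f t) = (\<Sum>t\<in>\<beta>'. f (t + M))"
      using \<beta>' by (intro sum.cong) (auto simp: shift_def Pf_def)
    also have "\<dots> = (\<Sum>t\<in>\<beta>. f t)" unfolding \<beta>_def by (subst sum.reindex) auto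
    finally show ?thesis .
  qed
  have "in_star xs (int (s + a) + poly P (int (y + (\<Sum>t\<in>\<beta>. f t))))"
    if "K \<subset> G" "reach \<phi> K (xs, s, P, y)" "f \<in> G" for K xs s P y f
  proof -
    have C: "(xs, s, P, y) \<in> C" using that by (auto simp: C_def)
    define Q where "Q = pcompose P [:int y, 1:] - [:poly P (int y):]"
    have "Q \<in> F" unfolding F_def Q_def using C by force
    from *[OF this, of "shift f"] \<open>f \<in> G\<close> obtain x where
      x: "int a + poly Q (int (\<Sum>t\<in>\<beta>. f t)) = int x" "E x" unfolding sum_shift by blast
    from x(2) C have "in_star xs (int s + poly P (int y) + int x)" unfolding E_def by blast
    then show ?thesis by (simp flip: x(1) add: Q_def poly_pcompose algebra_simps)
  qed
  moreover have "block_less (snd (\<phi> K)) \<beta>" if "K \<subset> G" "K \<noteq> {}" for K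
  proof -
    have "Max (snd (\<phi> K)) \<le> M" using block[OF that] M[OF that] by (auto simp: Pf_def)
    also have "M < Min \<beta>" using \<beta>' by (auto simp: \<beta>_def Pf_def)
    finally show ?thesis by (simp add: block_less_def)
  qed
  ultimately have "good \<phi> G (a, \<beta>)" using a \<beta> by (simp add: good_def)
  then show ?thesis ..
qed

text \<open>The recursion is along proper inclusion of finite sets; by \<open>reach_cong\<close>,
  \<open>good\<close> at \<open>G\<close> consults \<open>\<phi>\<close> only at proper
  subsets.\<close>

lemma good_choice: "\<exists>\<phi>. \<forall>G. good \<phi> G (\<phi> G)"
proof (rule dependent_wf_choice[OF wf_finite_psubset])
  fix \<phi> \<psi> :: "(nat \<Rightarrow> nat) set \<Rightarrow> nat \<times> nat set" and G r
  assume eq: "\<And>K. (K, G) \<in> finite_psubset \<Longrightarrow> \<phi> K = \<psi> K"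
  show "good \<phi> G r = good \<psi> G r"
  proof (cases "G \<in> Pf pos_seqs")
    case True
    then have eq: "\<phi> K = \<psi> K" if "K \<subset> G" for K using eq that by (auto simp: Pf_def)
    have "reach \<phi> K c \<longleftrightarrow> reach \<psi> K c" if "K \<subset> G" for K c
      using that eq reach_cong[of \<phi> K c \<psi>] reach_cong[of \<psi> K c \<phi>] by (metis subset_psubset_trans)
    then show ?thesis using eq unfolding good_def by auto
  qed (simp add: good_def)
next
  fix \<phi> and G :: "(nat \<Rightarrow> nat) set"
  assume *: "\<And>K. (K, G) \<in> finite_psubset \<Longrightarrow> good \<phi> K (\<phi> K)"
  show "\<exists>r. good \<phi> G r"
  proof (cases "G \<in> Pf pos_seqs")
    case True
    then show ?thesis using * by (intro good_exists) (auto simp: Pf_def)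
  qed (simp add: good_def)
qed

section \<open>Tuples built along an increasing chain\<close>

text \<open>The indices of a block are absorbed in increasing order, one \<open>step\<close> each;
  inserting the maximum last matches this order.\<close>

lemma reach_block:
  fixes G :: "nat \<Rightarrow> (nat \<Rightarrow> nat) set"
  assumes mono: "\<And>i j. 1 \<le> i \<Longrightarrow> i < j \<Longrightarrow> G i \<subset> G j" and f: "\<And>i. 1 \<le> i \<Longrightarrow> f i \<in> G i"
    and K: "reach \<phi> K (xs, s, P, y)" 
    and \<gamma>: "finite \<gamma>" "\<gamma> \<noteq> {}" "\<gamma> \<subseteq> pos_nats" "K \<subset> G (Min \<gamma>)"
  shows "reach \<phi> (G (Max \<gamma>))
    (xs, s + (\<Sum>i\<in>\<gamma>. fst (\<phi> (G i))), P, y + (\<Sum>i\<in>\<gamma>. \<Sum>t\<in>snd (\<phi> (G i)). f i t))"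
  using \<gamma>
proof (induction \<gamma> rule: finite_linorder_max_induct)
  case (insert b \<gamma>)
  have b: "b \<ge> 1" "b \<notin> \<gamma>" using insert by auto
  show ?case
  proof (cases "\<gamma> = {}")
    case True
    then show ?thesis using reach.step[OF K _ f[OF b(1)]] insert.prems by simp
  next
    case False
    have "Min \<gamma> < b" "Max \<gamma> < b" using insert.hyps False by auto
    moreover have "1 \<le> Max \<gamma>" using insert False by (meson Max_in atLeast_iff insert_subset subset_eq)
    ultimately have "G (Max \<gamma>) \<subset> G b" "Min (insert b \<gamma>) = Min \<gamma>" "Max (insert b \<gamma>) = b"
      using mono insert.hyps False by auto
    with reach.step[OF insert.IH _ f[OF b(1)]] insert False b(2)
    show ?thesis by (simp add: add_ac)
  qed
qed simp

text \<open>Block \<open>\<beta> j\<close> builds the entry \<open>z j\<close>, and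
  \<open>close\<close> passes to the next one. The last entry is not closed but read off from its
  star set.\<close>

lemma chain_in_tree:
  fixes G :: "nat \<Rightarrow> (nat \<Rightarrow> nat) set" and P :: "nat \<Rightarrow> int poly"
  assumes good: "\<And>G. good \<phi> G (\<phi> G)"
    and G: "\<And>i. i \<in> pos_nats \<Longrightarrow> G i \<in> Pf pos_seqs" "\<And>i. i \<in> pos_nats \<Longrightarrow> G i \<subset> G (Suc i)"
    and \<beta>: "\<And>j. j \<in> {1..m} \<Longrightarrow> \<beta> j \<in> Pf pos_nats"
      "\<And>j. j \<in> {1..<m} \<Longrightarrow> block_less (\<beta> j) (\<beta> (Suc j))"
    and f: "\<And>i. i \<in> pos_nats \<Longrightarrow> f i \<in> G i" and P: "\<And>j. j \<in> {1..m} \<Longrightarrow> P j \<in> T"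
  shows "map (\<lambda>j. int (\<Sum>i\<in>\<beta> j. fst (\<phi> (G i))) +
    poly (P j) (int (\<Sum>i\<in>\<beta> j. \<Sum>t\<in>snd (\<phi> (G i)). f i t))) [1..<Suc m]
    \<in> map int ` {xs \<in> D. length xs = m}"
proof -
  define s where "s j = (\<Sum>i\<in>\<beta> j. fst (\<phi> (G i)))" for j
  define y where "y j = (\<Sum>i\<in>\<beta> j. \<Sum>t\<in>snd (\<phi> (G i)). f i t)" for j
  define z where "z j = nat (int (s j) + poly (P j) (int (y j)))" for j
  have mono: "G i \<subset> G j" if "1 \<le> i" "i < j" for i j
    using that(2,1) by (induction i j rule: less_Suc_induct) (use G(2) in auto)
  have f': "f i \<in> G i" if "1 \<le> i" for i using f that by simp
  have \<beta>': "finite (\<beta> j)" "\<beta> j \<noteq> {}" "\<beta> j \<subseteq> pos_nats" if "j \<in> {1..m}" for j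
    using \<beta>(1)[OF that] by (auto simp: Pf_def)
  \<comment> \<open>A positive sum permits \<open>close\<close> and shows that the entry has
    begun.\<close>
  have pos: "s j > 0" if j: "j \<in> {1..m}" for j
  proof -
    have "fst (\<phi> (G i)) > 0" if "i \<in> \<beta> j" for i
      using good[of "G i"] G(1)[of i] that \<beta>'(3)[OF j] by (auto simp: good_def)
    then show ?thesis using \<beta>'(1,2)[OF j] by (simp add: s_def sum_pos)
  qed
  have reach: "reach \<phi> (G (Max (\<beta> j))) (map z [1..<j], s j, P j, y j)" if "1 \<le> j" "j \<le> m" for j
    using that
  proof (induction j rule: dec_induct)
    case base
    have "1 \<in> {1..m}" using m by simp
    note b = \<beta>'[OF this] and start = reach.start[OF P[OF this], of \<phi>]
    have "Min (\<beta> 1) \<in> pos_nats" using b by (meson Min_in subsetD)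
    then have "{} \<subset> G (Min (\<beta> 1))" using f by blast
    from reach_block[where G = G and f = f, OF mono f' start b this] show ?case by (simp add: s_def y_def)
  next
    case (step j)
    then have j: "j \<in> {1..m}" "Suc j \<in> {1..m}" "j \<in> {1..<m}" by auto
    have "reach \<phi> (G (Max (\<beta> j))) (map z [1..<j], s j, P j, y j)" using step by simp
    from reach.close[OF this pos[OF j(1)] _ P[OF j(2)]] step.hyps step.prems
    have close: "reach \<phi> (G (Max (\<beta> j))) (map z [1..<Suc j], 0, P (Suc j), 0)"
      by (simp add: z_def)
    have "Max (\<beta> j) \<in> pos_nats" using \<beta>'[OF j(1)] by (meson Max_in subsetD)
    \<comment> \<open>The gap between consecutive blocks makes the chain of sets continue
      strictly.\<close>
    then have "G (Max (\<beta> j)) \<subset> G (Min (\<beta> (Suc j)))"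
      using \<beta>(2)[OF j(3)] by (intro mono) (auto simp: block_less_def)
    from reach_block[where G = G and f = f, OF mono f' close \<beta>'[OF j(2)] this] show ?case by (simp add: s_def y_def)
  qed
  have in_star: "map z [1..<j] \<in> D \<and> in_star (map z [1..<j]) (int (s j) + poly (P j) (int (y j)))"
    if j: "j \<in> {1..m}" for j
  proof -
    have "Max (\<beta> j) \<in> pos_nats" using \<beta>'[OF j] by (meson Max_in subsetD)
    from G(1)[OF this] have "G (Max (\<beta> j)) \<subseteq> pos_seqs" "finite (G (Max (\<beta> j)))"
      by (auto simp: Pf_def)
    from valid_reach[OF reach this good] j pos[OF j] show ?thesis by (auto simp: valid_def)
  qed
  \<comment> \<open>Star sets contain only positive values, so \<open>nat\<close> loses
    nothing.\<close>
  have z: "int (z j) = int (s j) + poly (P j) (int (y j))" if "j \<in> {1..m}" for j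
    using in_star[OF that] by (auto simp: in_star_def z_def)
  have "map (\<lambda>j. int (s j) + poly (P j) (int (y j))) [1..<Suc m] = map int (map z [1..<Suc m])"
    unfolding map_map by (intro map_cong) (auto simp: z)
  \<comment> \<open>The star condition at \<open>j = m\<close> contains the membership of the
    completed list in \<open>D\<close>.\<close>
  moreover have "map z [1..<Suc m] \<in> {xs \<in> D. length xs = m}"
    using in_star[of m] m by (auto simp: in_star_def z_def)
  ultimately show ?thesis unfolding s_def y_def by (rule image_eqI)
qed

end

theorem corollary1p28:
  fixes m :: nat and p :: "nat filter" and A :: "nat list set" and T :: "int poly set"
  assumes "m \<ge> 1"
    and "minimal_idempotent p \<or> (uf_idempotent p \<and> p \<in> Jp)"
    and "A \<subseteq> pos_tuples m" and "\<forall>\<^sub>F xs in tensor (\<lambda>_. p) m. xs \<in> A"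
    and "T \<in> Pf int_polys0"
  shows "\<exists>\<alpha> \<in> Pf pos_seqs \<rightarrow> pos_nats. \<exists>H \<in> Pf pos_seqs \<rightarrow> Pf pos_nats.
    (\<forall>G \<in> Pf pos_seqs. \<forall>K \<in> Pf pos_seqs. G \<subset> K \<longrightarrow> block_less (H G) (H K)) \<and>
    (\<forall>G :: nat \<Rightarrow> (nat \<Rightarrow> nat) set.
      (\<forall>i \<in> pos_nats. G i \<in> Pf pos_seqs) \<and> (\<forall>i \<in> pos_nats. G i \<subset> G (Suc i)) \<longrightarrow>
      (\<forall>\<beta> :: nat \<Rightarrow> nat set. \<forall>f :: nat \<Rightarrow> nat \<Rightarrow> nat. \<forall>P :: nat \<Rightarrow> int poly.
        (\<forall>j \<in> {1..m}. \<beta> j \<in> Pf pos_nats) \<and> (\<forall>j \<in> {1..<m}. block_less (\<beta> j) (\<beta> (Suc j))) \<and>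
        (\<forall>i \<in> pos_nats. f i \<in> G i) \<and> (\<forall>j \<in> {1..m}. P j \<in> T) \<longrightarrow>
        map (\<lambda>j. int (\<Sum>i\<in>\<beta> j. \<alpha> (G i)) + poly (P j) (int (\<Sum>i\<in>\<beta> j. \<Sum>t\<in>H (G i). f i t))) [1..<Suc m]
          \<in> map int ` A))"
proof -
  have p: "uf_idempotent p" "p \<in> Jp"
    using assms(2) minimal_idempotent_Jp by (auto simp: minimal_idempotent_def)
  obtain D where D: "[] \<in> D" "\<And>xs. xs \<in> D \<Longrightarrow> length xs < m \<Longrightarrow> \<forall>\<^sub>F x in p. xs @ [x] \<in> D"
    "\<And>xs. xs \<in> D \<Longrightarrow> length xs = m \<Longrightarrow> xs \<in> A"
    using tensor_tree[OF assms(1,4)] by blast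
  interpret polynomial_central p D m T
    using p D(1,2) assms(1,5) by unfold_locales
  obtain \<phi> where \<phi>: "\<And>G. good \<phi> G (\<phi> G)" using good_choice by blast
  show ?thesis
  proof (intro bexI[of _ "fst \<circ> \<phi>"] bexI[of _ "snd \<circ> \<phi>"] conjI ballI impI allI)
    fix G K :: "(nat \<Rightarrow> nat) set"
    assume "G \<in> Pf pos_seqs" "K \<in> Pf pos_seqs" "G \<subset> K"
    then show "block_less ((snd \<circ> \<phi>) G) ((snd \<circ> \<phi>) K)"
      using \<phi>[of K] by (auto simp: good_def Pf_def)
  next
    fix G :: "nat \<Rightarrow> (nat \<Rightarrow> nat) set" and \<beta> :: "nat \<Rightarrow> nat set" and f P
    assume G: "(\<forall>i\<in>pos_nats. G i \<in> Pf pos_seqs) \<and> (\<forall>i\<in>pos_nats. G i \<subset> G (Suc i))"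
      and h: "(\<forall>j\<in>{1..m}. \<beta> j \<in> Pf pos_nats) \<and> (\<forall>j\<in>{1..<m}. block_less (\<beta> j) (\<beta> (Suc j))) \<and>
        (\<forall>i\<in>pos_nats. f i \<in> G i) \<and> (\<forall>j\<in>{1..m}. P j \<in> T)"
    have "map (\<lambda>j. int (\<Sum>i\<in>\<beta> j. fst (\<phi> (G i))) +
        poly (P j) (int (\<Sum>i\<in>\<beta> j. \<Sum>t\<in>snd (\<phi> (G i)). f i t))) [1..<Suc m]
      \<in> map int ` {xs \<in> D. length xs = m}"
      by (rule chain_in_tree[OF \<phi>]) (use G h in blast)+
    then show "map (\<lambda>j. int (\<Sum>i\<in>\<beta> j. (fst \<circ> \<phi>) (G i)) +
        poly (P j) (int (\<Sum>i\<in>\<beta> j. \<Sum>t\<in>(snd \<circ> \<phi>) (G i). f i t))) [1..<Suc m] \<in> map int ` A"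
      using D(3) unfolding comp_def by blast
  next
    show "fst \<circ> \<phi> \<in> Pf pos_seqs \<rightarrow> pos_nats" "snd \<circ> \<phi> \<in> Pf pos_seqs \<rightarrow> Pf pos_nats"
      using \<phi> by (auto simp: good_def)
  qed
qed

end
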